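(* Let $f\in \mathrm{Diff}^1_+([0,1])$ be a diffeomorphism without hyperbolic fixed points, let $x_0\in[0,1]$ with $f(x_0)\neq x_0$, and let $G\subset \mathrm{Diff}^1_+([0,1])$ be a group whose elements are all supported in the fundamental domain $J$ of $f$ with endpoints $x_0$ and $f(x_0)$. Assume there is a path $(h_t)_{t\in[0,1)}$ in $\mathrm{Diff}^1_+([0,1])$, continuous for the $C^1$-topology, such that every $h_t$ is supported in $J$ and $h_t g h_t^{-1}\to\mathrm{id}$ in the $C^1$-topology as $t\to1$ for every $g\in G$. Then there is a $C^1$-continuous path $(H_t)_{t\in[0,1)}$ in $\mathrm{Diff}^1_+([0,1])$ such that each $H_t$ is supported in the support of $f$, $DH_t(0)=DH_t(1)=1$, and $H_t g H_t^{-1}\to\mathrm{id}$ in the $C^1$-topology as $t\to 1$ for every $g$ in the group $\langle f,G\rangle$ generated by $f$ and $G$. In particular $\langle f,G\rangle$ is $C^1$-close to the identity.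
   Context: A diffeomorphism $f$ is without hyperbolic fixed points if $Df(x)=1$ for every fixed point $x$ of $f$. The support of a homeomorphism is the closure of the set of non-fixed points. A group $G\subset \mathrm{Diff}^1_+([0,1])$ is $C^1$-close to the identity if there is a sequence $h_n\in \mathrm{Diff}^1_+([0,1])$ such that $h_n g h_n^{-1}\to \mathrm{id}$ in the $C^1$-topology for every $g\in G$. *)

theory Defs
  imports "HOL-Analysis.Analysis"
begin

text \<open>Convention: an element of Diff^1_+([0,1]) is represented as a function
  real => real that is the identity outside [0,1]; then composition and the
  inverse below make Diff^1_+([0,1]) an honest group under (o) with unit id.\<close>

definition D :: "(real \<Rightarrow> real) \<Rightarrow> real \<Rightarrow> real" where
  "D f x = (THE d. (f has_real_derivative d) (at x within {0..1}))"

definition diff1p :: "(real \<Rightarrow> real) \<Rightarrow> bool" where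
  "diff1p f \<longleftrightarrow>
     (\<forall>x. x \<notin> {0..1} \<longrightarrow> f x = x) \<and>
     f ` {0..1} = {0..1} \<and>
     (\<forall>x\<in>{0..1}. \<exists>d>0. (f has_real_derivative d) (at x within {0..1})) \<and>
     continuous_on {0..1} (D f)"

definition dinv :: "(real \<Rightarrow> real) \<Rightarrow> real \<Rightarrow> real" where
  "dinv f = (\<lambda>x. if x \<in> {0..1} then inv_into {0..1} f x else x)"

definition conj :: "(real \<Rightarrow> real) \<Rightarrow> (real \<Rightarrow> real) \<Rightarrow> real \<Rightarrow> real" where
  "conj h g = h \<circ> g \<circ> dinv h"

definition C1dist :: "(real \<Rightarrow> real) \<Rightarrow> (real \<Rightarrow> real) \<Rightarrow> real" where
  "C1dist f g = (SUP x\<in>{0..1}. \<bar>f x - g x\<bar>) + (SUP x\<in>{0..1}. \<bar>D f x - D g x\<bar>)"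

definition supp :: "(real \<Rightarrow> real) \<Rightarrow> real set" where
  "supp f = closure {x \<in> {0..1}. f x \<noteq> x}"

definition no_hyperbolic_fixed_points :: "(real \<Rightarrow> real) \<Rightarrow> bool" where
  "no_hyperbolic_fixed_points f \<longleftrightarrow> (\<forall>x\<in>{0..1}. f x = x \<longrightarrow> D f x = 1)"

definition is_diff_group :: "(real \<Rightarrow> real) set \<Rightarrow> bool" where
  "is_diff_group G \<longleftrightarrow> (\<forall>g\<in>G. diff1p g) \<and> id \<in> G \<and>
     (\<forall>g\<in>G. \<forall>h\<in>G. g \<circ> h \<in> G) \<and> (\<forall>g\<in>G. dinv g \<in> G)"

inductive_set gen_group :: "(real \<Rightarrow> real) set \<Rightarrow> (real \<Rightarrow> real) set" for S where
  gen_base: "g \<in> S \<Longrightarrow> g \<in> gen_group S"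
| gen_id: "id \<in> gen_group S"
| gen_comp: "g \<in> gen_group S \<Longrightarrow> h \<in> gen_group S \<Longrightarrow> g \<circ> h \<in> gen_group S"
| gen_inv: "g \<in> gen_group S \<Longrightarrow> dinv g \<in> gen_group S"

definition C1_close_to_id :: "(real \<Rightarrow> real) set \<Rightarrow> bool" where
  "C1_close_to_id K \<longleftrightarrow> (\<exists>h :: nat \<Rightarrow> real \<Rightarrow> real. (\<forall>n. diff1p (h n)) \<and>
     (\<forall>g\<in>K. (\<lambda>n. C1dist (conj (h n) g) id) \<longlonglongrightarrow> 0))"

definition C1_path :: "(real \<Rightarrow> real \<Rightarrow> real) \<Rightarrow> bool" where
  "C1_path h \<longleftrightarrow> (\<forall>t\<in>{0..<1}. diff1p (h t)) \<and>
     (\<forall>t0\<in>{0..<1}. ((\<lambda>t. C1dist (h t) (h t0)) \<longlongrightarrow> 0) (at t0 within {0..<1}))"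

end

theory Submission
  imports Defs
begin

text \<open>
  Conjugation by \<open>H\<close> makes \<open>g\<close> close to the identity in the \<open>C\<^sup>1\<close> sense as soon as the density \<open>D H\<close> is
  almost invariant under pullback by \<open>g\<close>, a condition that is stable under convex combinations of \<open>H\<close>. Hence a
  sequence of conjugating maps suffices, and piecewise linear interpolation makes it a path.

  For any diffeomorphism \<open>k\<close>, the weighted average of the maps \<open>k \<circ> f\<^sup>i\<close> over all integers \<open>i\<close>, with weights
  decaying like \<open>exp (- d \<bar>i\<bar>)\<close>, has a density that \<open>f\<close> changes at most by a factor \<open>exp d\<close>. The
  average converges in the \<open>C\<^sup>1\<close> topology because the derivatives of the iterates of \<open>f\<close> grow subexponentially in
  the absence of hyperbolic fixed points.

  Finally \<open>k\<close> is chosen such that, on the fundamental domain, the density of the average is up to a factor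
  close to 1 and a constant the pullback by \<open>h\<^sub>t\<close> of a density \<open>B\<close> that depends only on \<open>f\<close>. As \<open>B\<close> is fixed,
  every \<open>g\<close> for which \<open>h\<^sub>t \<circ> g \<circ> h\<^sub>t\<^sup>-\<^sup>1\<close> is close to the identity almost preserves it, with no uniformity over
  the group required.
\<close>

section \<open>The group of diffeomorphisms of the interval\<close>

text \<open>\<open>D\<close> is a definite description. No point of \<open>{0..1}\<close> is
  isolated, so limits of difference quotients are unique and any derivative exhibited is the value
  of \<open>D\<close>.\<close>

lemma D_eq:
  assumes "(f has_real_derivative d) (at x within {0..1})" "x \<in> {0..1}"
  shows "D f x = d"
proof -
  have nb: "at x within {0..1} \<noteq> bot"
    using assms(2) by (auto simp: trivial_limit_within islimpt_Icc)
  have "d' = d" if "(f has_real_derivative d') (at x within {0..1})" for d'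
  proof -
    have "((\<lambda>y. (f y - f x) / (y - x)) \<longlongrightarrow> d') (at x within {0..1})"
      "((\<lambda>y. (f y - f x) / (y - x)) \<longlongrightarrow> d) (at x within {0..1})"
      using that assms(1) by (simp_all add: has_field_derivative_iff)
    then show ?thesis using nb tendsto_unique by blast
  qed
  then show ?thesis unfolding D_def using assms(1) by blast
qed

lemma diff1p_deriv:
  assumes "diff1p f" "x \<in> {0..1}"
  shows "(f has_real_derivative D f x) (at x within {0..1})" "D f x > 0"
proof -
  obtain d where "d > 0" "(f has_real_derivative d) (at x within {0..1})"
    using assms unfolding diff1p_def by blast
  then show "(f has_real_derivative D f x) (at x within {0..1})" "D f x > 0"
    using D_eq assms(2) by auto
qed

lemma diff1p_D_continuous: "diff1p f \<Longrightarrow> continuous_on {0..1} (D f)"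
  by (simp add: diff1p_def)

lemma diff1p_outside: "diff1p f \<Longrightarrow> x \<notin> {0..1} \<Longrightarrow> f x = x"
  by (simp add: diff1p_def)

lemma diff1p_image: "diff1p f \<Longrightarrow> f ` {0..1} = {0..1}"
  by (simp add: diff1p_def)

lemma diff1p_in: "diff1p f \<Longrightarrow> x \<in> {0..1} \<Longrightarrow> f x \<in> {0..1}"
  using diff1p_image by blast

lemma strict_increasing_if_deriv_pos:
  fixes f d :: "real \<Rightarrow> real"
  assumes "\<And>x. x \<in> {0..1} \<Longrightarrow> (f has_real_derivative d x) (at x within {0..1})"
    and "\<And>x. x \<in> {0..1} \<Longrightarrow> d x > 0"
    and "x \<in> {0..1}" "y \<in> {0..1}" "x < y"
  shows "f x < f y"
proof -
  have "(f has_derivative (\<lambda>h. h * d z)) (at z within {x..y})" if "x \<le> z" "z \<le> y" for z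
  proof -
    have "(f has_real_derivative d z) (at z within {x..y})"
      using that assms by (intro DERIV_subset[OF assms(1)]) auto
    then show ?thesis by (simp add: has_field_derivative_def mult.commute[of _ "d z"] mult_commute_abs)
  qed
  from mvt_simple[OF \<open>x < y\<close> this] obtain z where z: "z \<in> {x<..<y}" "f y - f x = (y - x) * d z"
    by auto
  moreover have "d z > 0" using z assms by auto
  ultimately show ?thesis using \<open>x < y\<close> by (metis diff_gt_0_iff_gt mult_pos_pos)
qed

lemma diff1p_less: "diff1p f \<Longrightarrow> x \<in> {0..1} \<Longrightarrow> y \<in> {0..1} \<Longrightarrow> x < y \<Longrightarrow> f x < f y"
  using strict_increasing_if_deriv_pos[of f "D f"] diff1p_deriv by blast

lemma diff1p_strict_mono:
  assumes "diff1p f" shows "strict_mono f"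
proof (rule strict_monoI)
  fix x y :: real assume "x < y"
  then show "f x < f y"
    using diff1p_less[OF assms, of x y] diff1p_outside[OF assms, of x] diff1p_outside[OF assms, of y]
      diff1p_in[OF assms, of x] diff1p_in[OF assms, of y]
    by (cases "x \<in> {0..1}"; cases "y \<in> {0..1}") auto
qed

lemma diff1p_mono: "diff1p f \<Longrightarrow> x \<le> y \<Longrightarrow> f x \<le> f y"
  using diff1p_strict_mono strict_mono_less_eq by blast

lemma diff1p_inj: "diff1p f \<Longrightarrow> f x = f y \<longleftrightarrow> x = y"
  using diff1p_strict_mono strict_mono_eq by blast

lemma diff1p_0: assumes "diff1p f" shows "f 0 = 0"
proof -
  obtain x where "x \<in> {0..1}" "f x = 0" using diff1p_image[OF assms] by (metis atLeastAtMost_iff image_iff order_refl zero_le_one)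
  moreover have "f 0 \<ge> 0" using diff1p_in[OF assms, of 0] by auto
  ultimately show ?thesis using diff1p_mono[OF assms, of 0 x] by auto
qed

lemma diff1p_1: assumes "diff1p f" shows "f 1 = 1"
proof -
  obtain x where "x \<in> {0..1}" "f x = 1" using diff1p_image[OF assms] by (metis atLeastAtMost_iff image_iff order_refl zero_le_one)
  moreover have "f 1 \<le> 1" using diff1p_in[OF assms, of 1] by auto
  ultimately show ?thesis using diff1p_mono[OF assms, of x 1] by auto
qed

lemma diff1p_continuous: "diff1p f \<Longrightarrow> continuous_on {0..1} f"
  using diff1p_deriv(1) DERIV_continuous_on by blast

text \<open>Surjectivity follows from the endpoint values by monotonicity and the intermediate value
  theorem, so later constructions have to control only endpoints and derivative.\<close>

lemma diff1pI:
  assumes out: "\<And>x. x \<notin> {0..1} \<Longrightarrow> f x = x"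
    and "f 0 = 0" "f 1 = 1"
    and der: "\<And>x. x \<in> {0..1} \<Longrightarrow> (f has_real_derivative d x) (at x within {0..1})"
    and pos: "\<And>x. x \<in> {0..1} \<Longrightarrow> d x > 0"
    and cont: "continuous_on {0..1} d"
  shows "diff1p f"
proof -
  have Deq: "D f x = d x" if "x \<in> {0..1}" for x using D_eq der that by blast
  have "continuous_on {0..1} (D f)" using continuous_on_cong[OF refl, of "{0..1}" "D f" d] cont Deq by blast
  moreover have "f ` {0..1} = {0..1}"
  proof
    show "f ` {0..1} \<subseteq> {0..1}"
    proof
      fix y assume "y \<in> f ` {0..1}"
      then obtain x where x: "x \<in> {0..1}" "y = f x" by auto
      have "f 0 \<le> f x" "f x \<le> f 1"
        using strict_increasing_if_deriv_pos[OF der pos, of 0 x] strict_increasing_if_deriv_pos[OF der pos, of x 1] x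
        by (cases "x = 0"; cases "x = 1"; force)+
      then show "y \<in> {0..1}" using x assms(2,3) by auto
    qed
    have "continuous_on {0..1} f" using der DERIV_continuous_on by blast
    then show "{0..1} \<subseteq> f ` {0..1}"
      using IVT'[of f 0 _ 1] assms(2,3) by (force simp: image_iff)
  qed
  ultimately show ?thesis using out der pos unfolding diff1p_def by blast
qed

lemma diff1p_comp:
  assumes f: "diff1p f" and g: "diff1p g"
  shows "diff1p (f \<circ> g)"
    and "x \<in> {0..1} \<Longrightarrow> D (f \<circ> g) x = D f (g x) * D g x"
proof -
  have der: "((f \<circ> g) has_real_derivative D f (g x) * D g x) (at x within {0..1})" if "x \<in> {0..1}" for x
  proof (rule DERIV_image_chain)
    show "(f has_real_derivative D f (g x)) (at (g x) within g ` {0..1})"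
      using diff1p_deriv[OF f diff1p_in[OF g that]] diff1p_image[OF g] by simp
  qed (use diff1p_deriv[OF g that] in blast)
  show "diff1p (f \<circ> g)"
  proof (rule diff1pI[OF _ _ _ der])
    show "D f (g x) * D g x > 0" if "x \<in> {0..1}" for x
      using diff1p_deriv(2)[OF f diff1p_in[OF g that]] diff1p_deriv(2)[OF g that] by simp
    show "continuous_on {0..1} (\<lambda>x. D f (g x) * D g x)"
      by (intro continuous_intros continuous_on_compose2[OF diff1p_D_continuous[OF f] diff1p_continuous[OF g]]
          diff1p_D_continuous g) (use diff1p_image[OF g] in auto)
  qed (use diff1p_outside[OF f] diff1p_outside[OF g] diff1p_0[OF f] diff1p_0[OF g] diff1p_1[OF f] diff1p_1[OF g] in auto)
  show "D (f \<circ> g) x = D f (g x) * D g x" if "x \<in> {0..1}"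
    using der D_eq that by blast
qed

lemma diff1p_id: "diff1p id" and D_id: "x \<in> {0..1} \<Longrightarrow> D id x = 1"
proof -
  have der: "(id has_real_derivative 1) (at x within {0..1})" for x :: real
    by (simp add: id_def)
  show "diff1p id" by (rule diff1pI[OF _ _ _ der]) auto
  show "x \<in> {0..1} \<Longrightarrow> D id x = 1" using D_eq der by blast
qed

lemma dinv_right: assumes "diff1p f" shows "f (dinv f x) = x"
proof (cases "x \<in> {0..1}")
  case True
  then have "x \<in> f ` {0..1}" using diff1p_image[OF assms] by simp
  then show ?thesis using True by (simp add: dinv_def f_inv_into_f)
qed (use diff1p_outside[OF assms] in \<open>auto simp: dinv_def\<close>)

lemma dinv_left: assumes "diff1p f" shows "dinv f (f x) = x"
  using dinv_right[OF assms, of "f x"] diff1p_inj[OF assms] by simp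

lemma dinv_in: assumes "diff1p f" "x \<in> {0..1}" shows "dinv f x \<in> {0..1}"
  using assms inv_into_into[of x f "{0..1}"] diff1p_image[of f] by (simp add: dinv_def)

lemma diff1p_dinv:
  assumes f: "diff1p f"
  shows "diff1p (dinv f)"
    and "x \<in> {0..1} \<Longrightarrow> D (dinv f) x = inverse (D f (dinv f x))"
proof -
  have c: "continuous_on {0..1} (dinv f)"
  proof -
    have "continuous_on (f ` {0..1}) (dinv f)"
      by (rule continuous_on_inv[OF diff1p_continuous[OF f]]) (auto simp: dinv_left[OF f])
    then show ?thesis using diff1p_image[OF f] by simp
  qed
  have der: "(dinv f has_real_derivative inverse (D f (dinv f x))) (at x within {0..1})" if "x \<in> {0..1}" for x
  proof -
    have inx: "dinv f x \<in> {0..1}" using dinv_in[OF f that] .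
    \<comment> \<open>The difference quotient of \<open>f\<close> at \<open>dinv f x\<close> is
      composed with \<open>dinv f\<close>. Injectivity keeps the argument off the base point, and
      the reciprocal is the quotient of \<open>dinv f\<close>.\<close>
    have "filterlim (dinv f) (at (dinv f x) within {0..1}) (at x within {0..1})"
      unfolding filterlim_at
    proof
      show "\<forall>\<^sub>F z in at x within {0..1}. dinv f z \<in> {0..1} \<and> dinv f z \<noteq> dinv f x"
        unfolding eventually_at_filter using dinv_in[OF f] dinv_right[OF f]
        by (intro always_eventually) metis
      show "(dinv f \<longlongrightarrow> dinv f x) (at x within {0..1})"
        using c that by (simp add: continuous_on_def)
    qed
    from filterlim_compose[OF diff1p_deriv(1)[OF f inx, unfolded has_field_derivative_iff] this]
    have "((\<lambda>z. (z - x) / (dinv f z - dinv f x)) \<longlongrightarrow> D f (dinv f x)) (at x within {0..1})"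
      by (simp add: dinv_right[OF f])
    from tendsto_inverse[OF this] diff1p_deriv(2)[OF f inx] show ?thesis
      by (simp add: has_field_derivative_iff)
  qed
  show "diff1p (dinv f)"
  proof (rule diff1pI[OF _ _ _ der])
    show "inverse (D f (dinv f x)) > 0" if "x \<in> {0..1}" for x
      using diff1p_deriv(2)[OF f dinv_in[OF f that]] by simp
    show "continuous_on {0..1} (\<lambda>x. inverse (D f (dinv f x)))"
      using diff1p_deriv(2)[OF f dinv_in[OF f]]
      by (intro continuous_intros continuous_on_compose2[OF diff1p_D_continuous[OF f] c]) (use dinv_in[OF f] in \<open>force+\<close>)
  qed (use dinv_left[OF f, of 0] dinv_left[OF f, of 1] in \<open>auto simp: dinv_def diff1p_0[OF f] diff1p_1[OF f]\<close>)
  show "D (dinv f) x = inverse (D f (dinv f x))" if "x \<in> {0..1}"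
    using der D_eq that by blast
qed

section \<open>Almost invariant densities\<close>

lemma diff1p_convex:
  assumes f: "diff1p f" and g: "diff1p g" and s: "0 \<le> s" "s \<le> 1"
  shows "diff1p (\<lambda>x. (1 - s) * f x + s * g x)"
    and "x \<in> {0..1} \<Longrightarrow> D (\<lambda>x. (1 - s) * f x + s * g x) x = (1 - s) * D f x + s * D g x"
proof -
  have der: "((\<lambda>x. (1 - s) * f x + s * g x) has_real_derivative (1 - s) * D f x + s * D g x) (at x within {0..1})"
    if "x \<in> {0..1}" for x
    by (intro DERIV_add DERIV_cmult diff1p_deriv f g that)
  show "diff1p (\<lambda>x. (1 - s) * f x + s * g x)"
  proof (rule diff1pI[OF _ _ _ der])
    show "(1 - s) * f x + s * g x = x" if "x \<notin> {0..1}" for x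
      using diff1p_outside[OF f that] diff1p_outside[OF g that] by (simp add: algebra_simps)
    show "(1 - s) * D f x + s * D g x > 0" if "x \<in> {0..1}" for x
      using diff1p_deriv(2)[OF f that] diff1p_deriv(2)[OF g that] s
      by (cases "s = 0") (auto intro!: add_nonneg_pos)
    show "continuous_on {0..1} (\<lambda>x. (1 - s) * D f x + s * D g x)"
      by (intro continuous_intros diff1p_D_continuous f g)
  qed (use diff1p_0[OF f] diff1p_0[OF g] diff1p_1[OF f] diff1p_1[OF g] in auto)
  show "D (\<lambda>x. (1 - s) * f x + s * g x) x = (1 - s) * D f x + s * D g x" if "x \<in> {0..1}"
    using der D_eq that by blast
qed

section \<open>The C1 distance and its relation to almost invariance\<close>

lemma C1dist_bounded:
  assumes "diff1p f" "diff1p g"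
  shows "bdd_above ((\<lambda>x. \<bar>f x - g x\<bar>) ` {0..1})" "bdd_above ((\<lambda>x. \<bar>D f x - D g x\<bar>) ` {0..1})"
  using assms diff1p_continuous[of f] diff1p_continuous[of g] diff1p_D_continuous[of f] diff1p_D_continuous[of g]
  by (intro bounded_imp_bdd_above compact_imp_bounded compact_continuous_image continuous_intros; simp)+

lemma C1dist_upper:
  assumes "diff1p f" "diff1p g" "x \<in> {0..1}"
  shows "\<bar>f x - g x\<bar> \<le> C1dist f g" "\<bar>D f x - D g x\<bar> \<le> C1dist f g"
proof -
  have "\<bar>f x - g x\<bar> \<le> (SUP x\<in>{0..1}. \<bar>f x - g x\<bar>)" "\<bar>D f x - D g x\<bar> \<le> (SUP x\<in>{0..1}. \<bar>D f x - D g x\<bar>)"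
    using C1dist_bounded[OF assms(1,2)] assms(3) by (auto intro!: cSUP_upper)
  then show "\<bar>f x - g x\<bar> \<le> C1dist f g" "\<bar>D f x - D g x\<bar> \<le> C1dist f g"
    unfolding C1dist_def by linarith+
qed

lemma C1dist_nonneg: "diff1p f \<Longrightarrow> diff1p g \<Longrightarrow> 0 \<le> C1dist f g"
  using C1dist_upper(1)[of f g 0] by auto

lemma C1dist_le:
  assumes "\<And>x. x \<in> {0..1} \<Longrightarrow> \<bar>f x - g x\<bar> \<le> A" "\<And>x. x \<in> {0..1} \<Longrightarrow> \<bar>D f x - D g x\<bar> \<le> B"
  shows "C1dist f g \<le> A + B"
  unfolding C1dist_def using assms by (intro add_mono cSUP_least) auto

text \<open>The derivative of \<open>H \<circ> g \<circ> H\<^sup>-\<^sup>1\<close> at \<open>H x\<close> is \<open>D H (g x) * D g x / D H x\<close>, so the following says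
  that \<open>H\<close> conjugates \<open>g\<close> to a map with derivative in \<open>[exp (- e), exp e]\<close>. Written for the density
  \<open>D H\<close> alone, the condition is visibly stable under positive linear combinations.\<close>

definition quasi_inv :: "(real \<Rightarrow> real) \<Rightarrow> (real \<Rightarrow> real) \<Rightarrow> real \<Rightarrow> bool" where
  "quasi_inv H g e \<longleftrightarrow> (\<forall>x\<in>{0..1}. exp (- e) * D H x \<le> D H (g x) * D g x \<and>
     D H (g x) * D g x \<le> exp e * D H x)"

lemma diff1p_conj: "diff1p h \<Longrightarrow> diff1p g \<Longrightarrow> diff1p (conj h g)"
  unfolding conj_def by (intro diff1p_comp(1) diff1p_dinv(1))

text \<open>Evaluated at \<open>h x\<close>, which reaches every point of the interval, the
  derivative of the conjugate involves no inverse map.\<close>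

lemma D_conj:
  assumes h: "diff1p h" and g: "diff1p g" and x: "x \<in> {0..1}"
  shows "D (conj h g) (h x) = D h (g x) * D g x / D h x"
proof -
  have hx: "h x \<in> {0..1}" using diff1p_in[OF h x] .
  have "D (conj h g) (h x) = D (h \<circ> g) (dinv h (h x)) * D (dinv h) (h x)"
    unfolding conj_def by (rule diff1p_comp(2)[OF diff1p_comp(1)[OF h g] diff1p_dinv(1)[OF h] hx])
  also have "\<dots> = D h (g x) * D g x * inverse (D h x)"
    using diff1p_comp(2)[OF h g x] diff1p_dinv(2)[OF h hx] by (simp add: dinv_left[OF h])
  finally show ?thesis by (simp add: divide_inverse)
qed

text \<open>The derivative of the conjugate lies within \<open>exp e - 1\<close> of 1. As the
  conjugate fixes 0, the mean value theorem gives the same bound for the displacement.\<close>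

lemma quasi_inv_C1dist:
  assumes h: "diff1p h" and g: "diff1p g" and q: "quasi_inv h g e" and e: "e \<ge> 0"
  shows "C1dist (conj h g) id \<le> 2 * (exp e - 1)"
proof -
  let ?c = "conj h g"
  have c: "diff1p ?c" using diff1p_conj[OF h g] .
  have bound: "\<bar>D ?c y - 1\<bar> \<le> exp e - 1" if y: "y \<in> {0..1}" for y
  proof -
    obtain x where x: "x \<in> {0..1}" "y = h x" using y diff1p_image[OF h] by blast
    have pos: "D h x > 0" using diff1p_deriv(2)[OF h x(1)] .
    have "exp (-e) \<le> D ?c y" "D ?c y \<le> exp e"
      using q x pos unfolding quasi_inv_def x(2) D_conj[OF h g x(1)]
      by (auto simp: field_simps)
    moreover have "1 - exp (-e) \<le> exp e - 1"
    proof -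
      have "2 \<le> exp e + exp (-e)" using exp_ge_add_one_self[of e] exp_ge_add_one_self[of "-e"] by linarith
      then show ?thesis by simp
    qed
    ultimately show ?thesis by (simp add: abs_le_iff)
  qed
  have "\<bar>?c y - y\<bar> \<le> exp e - 1" if y: "y \<in> {0..1}" for y
  proof (cases "y = 0")
    case True
    then show ?thesis using diff1p_0[OF c] e by simp
  next
    case False
    have "((\<lambda>y. ?c y - y) has_derivative (\<lambda>h. h * (D ?c z - 1))) (at z within {0..y})" if "0 \<le> z" "z \<le> y" for z
    proof -
      have "(?c has_real_derivative D ?c z) (at z within {0..y})"
        using that y by (intro DERIV_subset[OF diff1p_deriv(1)[OF c]]) auto
      then have "((\<lambda>y. ?c y - y) has_real_derivative D ?c z - 1) (at z within {0..y})"
        by (intro derivative_eq_intros) auto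
      then show ?thesis by (simp add: has_field_derivative_def mult.commute[of _ "D ?c z - 1"] mult_commute_abs)
    qed
    from mvt_simple[OF _ this] obtain z where z: "z \<in> {0<..<y}" "?c y - y = y * (D ?c z - 1)"
      using False y diff1p_0[OF c] by auto
    then have "\<bar>?c y - y\<bar> = y * \<bar>D ?c z - 1\<bar>" using y by (simp add: abs_mult)
    also have "\<dots> \<le> 1 * (exp e - 1)" using z y by (intro mult_mono bound) auto
    finally show ?thesis by simp
  qed
  then have "C1dist ?c id \<le> (exp e - 1) + (exp e - 1)"
    using bound D_id by (intro C1dist_le) auto
  then show ?thesis by simp
qed

text \<open>A converse of \<open>quasi_inv_C1dist\<close>, used to turn the convergence assumed for
  the given conjugators into almost invariance. Of the two one-sided margins around 1,
  \<open>1 - exp (- \<eta>)\<close> is the smaller.\<close>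

lemma C1dist_quasi_inv:
  assumes h: "diff1p h" and p: "diff1p p" and near: "C1dist (conj h p) id < 1 - exp (- \<eta>)" and \<eta>: "\<eta> > 0"
  shows "quasi_inv h p \<eta>"
  unfolding quasi_inv_def
proof
  fix x :: real assume x: "x \<in> {0..1}"
  have hx: "h x \<in> {0..1}" using diff1p_in[OF h x] .
  have Dh: "0 < D h x" using diff1p_deriv(2)[OF h x] .
  have "\<bar>D (conj h p) (h x) - 1\<bar> < 1 - exp (- \<eta>)"
    using C1dist_upper(2)[OF diff1p_conj[OF h p] diff1p_id hx] D_id[OF hx] near by simp
  moreover have "1 - exp (- \<eta>) \<le> exp \<eta> - 1"
    using exp_ge_add_one_self[of \<eta>] exp_ge_add_one_self[of "- \<eta>"] by linarith
  ultimately have "exp (- \<eta>) \<le> D (conj h p) (h x)" "D (conj h p) (h x) \<le> exp \<eta>" by linarith+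
  then show "exp (- \<eta>) * D h x \<le> D h (p x) * D p x \<and> D h (p x) * D p x \<le> exp \<eta> * D h x"
    unfolding D_conj[OF h p x] using Dh by (simp add: pos_le_divide_eq pos_divide_le_eq)
qed

text \<open>Pulling back by a composition is pulling back twice, so the distortion factors multiply
  and the exponents add.\<close>

lemma quasi_inv_comp:
  assumes "diff1p g" "diff1p k" "quasi_inv H g e" "quasi_inv H k e'"
  shows "quasi_inv H (g \<circ> k) (e + e')"
  unfolding quasi_inv_def
proof
  fix x :: real assume x: "x \<in> {0..1}"
  have kx: "k x \<in> {0..1}" "D k x > 0" using diff1p_in assms(2) diff1p_deriv(2) x by auto
  have a: "exp (- e') * D H x \<le> D H (k x) * D k x" "D H (k x) * D k x \<le> exp e' * D H x"
    using assms(4) x unfolding quasi_inv_def by auto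
  have b: "exp (- e) * D H (k x) \<le> D H (g (k x)) * D g (k x)" "D H (g (k x)) * D g (k x) \<le> exp e * D H (k x)"
    using assms(3) kx unfolding quasi_inv_def by auto
  have "exp (-(e + e')) * D H x = exp (-e) * (exp (-e') * D H x)"
    by (simp add: exp_add[symmetric] mult.assoc[symmetric])
  also have "\<dots> \<le> exp (-e) * (D H (k x) * D k x)" using a by (intro mult_left_mono) auto
  also have "\<dots> = (exp (-e) * D H (k x)) * D k x" by simp
  also have "\<dots> \<le> D H (g (k x)) * D g (k x) * D k x" using b kx by (intro mult_right_mono) auto
  finally have 1: "exp (-(e + e')) * D H x \<le> D H ((g \<circ> k) x) * D (g \<circ> k) x"
    using diff1p_comp(2)[OF assms(1,2) x] by (simp add: mult.assoc)
  have "D H (g (k x)) * D g (k x) * D k x \<le> (exp e * D H (k x)) * D k x"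
    using b kx by (intro mult_right_mono) auto
  also have "\<dots> = exp e * (D H (k x) * D k x)" by simp
  also have "\<dots> \<le> exp e * (exp e' * D H x)" using a by (intro mult_left_mono) auto
  also have "\<dots> = exp (e + e') * D H x" by (simp add: exp_add)
  finally have "D H ((g \<circ> k) x) * D (g \<circ> k) x \<le> exp (e + e') * D H x"
    using diff1p_comp(2)[OF assms(1,2) x] by (simp add: mult.assoc)
  with 1 show "exp (-(e + e')) * D H x \<le> D H ((g \<circ> k) x) * D (g \<circ> k) x \<and>
      D H ((g \<circ> k) x) * D (g \<circ> k) x \<le> exp (e + e') * D H x" by blast
qed

lemma quasi_inv_dinv:
  assumes g: "diff1p g" and q: "quasi_inv H g e"
  shows "quasi_inv H (dinv g) e"
  unfolding quasi_inv_def
proof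
  fix y :: real assume y: "y \<in> {0..1}"
  define x where "x = dinv g y"
  have x: "x \<in> {0..1}" "g x = y" "D g x > 0"
    using dinv_in[OF g y] dinv_right[OF g] diff1p_deriv(2)[OF g] by (auto simp: x_def)
  have "exp (-e) * D H x \<le> D H y * D g x" "D H y * D g x \<le> exp e * D H x"
    using q x unfolding quasi_inv_def by auto
  moreover have eq: "D (dinv g) y = inverse (D g x)" using diff1p_dinv(2)[OF g y] by (simp add: x_def)
  ultimately show "exp (-e) * D H y \<le> D H (dinv g y) * D (dinv g) y \<and> D H (dinv g y) * D (dinv g) y \<le> exp e * D H y"
    using x(3) unfolding eq x_def[symmetric] by (simp add: field_simps exp_minus)
qed

lemma quasi_inv_id: "e \<ge> 0 \<Longrightarrow> diff1p H \<Longrightarrow> quasi_inv H id e"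
  using diff1p_deriv(2)[of H] by (auto simp: quasi_inv_def D_id less_imp_le)

text \<open>Both inequalities are linear in the density \<open>D H\<close>, although conjugation by
  \<open>H\<close> is not linear in \<open>H\<close>.\<close>

lemma quasi_inv_convex:
  assumes "diff1p H" "diff1p K" "diff1p g" "0 \<le> s" "s \<le> 1" "quasi_inv H g e" "quasi_inv K g e"
  shows "quasi_inv (\<lambda>x. (1 - s) * H x + s * K x) g e"
  unfolding quasi_inv_def
proof
  fix x :: real assume x: "x \<in> {0..1}"
  have gx: "g x \<in> {0..1}" using diff1p_in[OF assms(3) x] .
  note DD = diff1p_convex(2)[OF assms(1,2,4,5)]
  have a: "exp (-e) * D H x \<le> D H (g x) * D g x" "D H (g x) * D g x \<le> exp e * D H x"
    "exp (-e) * D K x \<le> D K (g x) * D g x" "D K (g x) * D g x \<le> exp e * D K x"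
    using assms(6,7) x unfolding quasi_inv_def by auto
  have "(1 - s) * (exp (-e) * D H x) + s * (exp (-e) * D K x) \<le> (1 - s) * (D H (g x) * D g x) + s * (D K (g x) * D g x)"
    "(1 - s) * (D H (g x) * D g x) + s * (D K (g x) * D g x) \<le> (1 - s) * (exp e * D H x) + s * (exp e * D K x)"
    using a assms(4,5) by (intro add_mono mult_left_mono; simp)+
  then show "exp (- e) * D (\<lambda>x. (1 - s) * H x + s * K x) x \<le> D (\<lambda>x. (1 - s) * H x + s * K x) (g x) * D g x \<and>
      D (\<lambda>x. (1 - s) * H x + s * K x) (g x) * D g x \<le> exp e * D (\<lambda>x. (1 - s) * H x + s * K x) x"
    unfolding DD[OF x] DD[OF gx] by (simp add: algebra_simps)
qed

text \<open>Induction over words in the generators. The claim is carried for all \<open>e\<close> at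
  once because a composition spends \<open>e / 2\<close> on each factor.\<close>

lemma quasi_inv_gen_group:
  assumes H: "\<And>n. diff1p (H n)"
    and S: "\<And>g. g \<in> S \<Longrightarrow> diff1p g"
    and q: "\<And>g e. g \<in> S \<Longrightarrow> e > 0 \<Longrightarrow> \<forall>\<^sub>F n in F. quasi_inv (H n) g e"
    and g: "g \<in> gen_group S"
  shows "diff1p g \<and> (\<forall>e>0. \<forall>\<^sub>F n in F. quasi_inv (H n) g e)"
  using g
proof induction
  case (gen_base g)
  then show ?case using S q by blast
next
  case gen_id
  show ?case
    by (intro conjI allI impI diff1p_id always_eventually quasi_inv_id H less_imp_le)
next
  case (gen_comp g h)
  have "\<forall>\<^sub>F n in F. quasi_inv (H n) (g \<circ> h) e" if "e > 0" for e
  proof -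
    have "\<forall>\<^sub>F n in F. quasi_inv (H n) g (e/2)" "\<forall>\<^sub>F n in F. quasi_inv (H n) h (e/2)"
      using gen_comp that by auto
    then show ?thesis
    proof eventually_elim
      case (elim n)
      then show ?case using quasi_inv_comp[of g h "H n" "e/2" "e/2"] gen_comp by simp
    qed
  qed
  then show ?case using gen_comp diff1p_comp by blast
next
  case (gen_inv g)
  then show ?case using diff1p_dinv(1) quasi_inv_dinv by (metis (mono_tags, lifting) eventually_mono)
qed

lemma quasi_inv_C1dist_tendsto:
  assumes H: "\<forall>\<^sub>F n in F. diff1p (H n)" and g: "diff1p g"
    and q: "\<And>e. e > 0 \<Longrightarrow> \<forall>\<^sub>F n in F. quasi_inv (H n) g e"
  shows "((\<lambda>n. C1dist (conj (H n) g) id) \<longlongrightarrow> 0) F"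
proof (rule tendstoI)
  fix d :: real assume d: "d > 0"
  \<comment> \<open>Makes \<open>2 * (exp e - 1)\<close> equal to \<open>d / 2\<close>, strictly
    below \<open>d\<close>.\<close>
  define e where "e = ln (1 + d / 4)"
  have e: "e > 0" "exp e = 1 + d / 4" using d by (auto simp: e_def)
  show "\<forall>\<^sub>F n in F. dist (C1dist (conj (H n) g) id) 0 < d"
    using H q[OF e(1)]
  proof eventually_elim
    case (elim n)
    have "C1dist (conj (H n) g) id \<le> d / 2"
      using quasi_inv_C1dist[OF elim(1) g elim(2)] e by simp
    moreover have "C1dist (conj (H n) g) id \<ge> 0"
      using C1dist_nonneg[OF diff1p_conj[OF elim(1) g] diff1p_id] .
    ultimately show ?case using d by simp
  qed
qed

section \<open>From sequences to paths\<close>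

definition interp :: "(nat \<Rightarrow> real \<Rightarrow> real) \<Rightarrow> real \<Rightarrow> real \<Rightarrow> real" where
  "interp H s = (\<lambda>x. (1 - frac s) * H (nat \<lfloor>s\<rfloor>) x + frac s * H (Suc (nat \<lfloor>s\<rfloor>)) x)"

text \<open>The formula of a piece extends to its right end, where \<open>floor\<close> jumps; hence
  neighbouring pieces fit together.\<close>

lemma interp_eq:
  assumes "real n \<le> s" "s \<le> real n + 1"
  shows "interp H s = (\<lambda>x. (1 - (s - real n)) * H n x + (s - real n) * H (Suc n) x)"
proof (cases "s = real n + 1")
  case True
  then have s: "s = real (Suc n)" by simp
  have "\<lfloor>s\<rfloor> = int (Suc n)" by (simp only: s floor_of_nat)
  then have nf: "nat \<lfloor>s\<rfloor> = Suc n" "frac s = 0" using True by (simp_all add: frac_def)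
  show ?thesis unfolding interp_def nf using True by simp
next
  case False
  then have "\<lfloor>s\<rfloor> = int n" using assms by (intro floor_unique) auto
  then show ?thesis by (simp add: interp_def frac_def)
qed

lemma diff1p_interp:
  assumes "\<And>n. diff1p (H n)"
  shows "diff1p (interp H s)"
    and "x \<in> {0..1} \<Longrightarrow> D (interp H s) x = (1 - frac s) * D (H (nat \<lfloor>s\<rfloor>)) x + frac s * D (H (Suc (nat \<lfloor>s\<rfloor>))) x"
  unfolding interp_def
  using diff1p_convex[OF assms assms] frac_ge_0[of s] frac_lt_1[of s] by auto

text \<open>On one piece the path is affine in the parameter, hence Lipschitz. The factor 2 arises
  because each of the two suprema in \<open>C1dist\<close> is bounded by the whole distance of the
  end maps.\<close>

lemma interp_C1dist:
  assumes H: "\<And>n. diff1p (H n)"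
    and s: "real n \<le> s" "s \<le> real n + 1" and s': "real n \<le> s'" "s' \<le> real n + 1"
  shows "C1dist (interp H s) (interp H s') \<le> \<bar>s - s'\<bar> * (2 * C1dist (H (Suc n)) (H n))"
proof -
  note C = C1dist_upper[OF H[of "Suc n"] H[of n]]
  have "C1dist (interp H s) (interp H s') \<le>
    \<bar>s - s'\<bar> * C1dist (H (Suc n)) (H n) + \<bar>s - s'\<bar> * C1dist (H (Suc n)) (H n)"
  proof (rule C1dist_le)
    fix x :: real assume x: "x \<in> {0..1}"
    have "interp H s x - interp H s' x = (s - s') * (H (Suc n) x - H n x)"
      unfolding interp_eq[OF s] interp_eq[OF s'] by (simp add: algebra_simps)
    then show "\<bar>interp H s x - interp H s' x\<bar> \<le> \<bar>s - s'\<bar> * C1dist (H (Suc n)) (H n)"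
      using C(1)[OF x] by (simp add: abs_mult mult_left_mono)
    have "D (interp H s) x - D (interp H s') x = (s - s') * (D (H (Suc n)) x - D (H n) x)"
      unfolding interp_eq[OF s] interp_eq[OF s'] using s s' x
      by (subst (1 2) diff1p_convex(2)[OF H H]) (auto simp: algebra_simps)
    then show "\<bar>D (interp H s) x - D (interp H s') x\<bar> \<le> \<bar>s - s'\<bar> * C1dist (H (Suc n)) (H n)"
      using C(2)[OF x] by (simp add: abs_mult mult_left_mono)
  qed
  then show ?thesis by simp
qed

lemma interp_continuous:
  assumes H: "\<And>n. diff1p (H n)" and s0: "s0 \<ge> 0"
    and \<sigma>: "(\<sigma> \<longlongrightarrow> s0) F" "\<forall>\<^sub>F t in F. \<sigma> t \<ge> 0"
  shows "((\<lambda>t. C1dist (interp H (\<sigma> t)) (interp H s0)) \<longlongrightarrow> 0) F"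
proof -
  define n where "n = nat \<lfloor>s0\<rfloor>"
  have n: "real n \<le> s0" "s0 < real n + 1" using s0 unfolding n_def by linarith+
  \<comment> \<open>Covers the pieces on both sides of \<open>s0\<close>. For \<open>n = 0\<close>
    the truncated \<open>n - 1\<close> merely repeats the first piece.\<close>
  define M where "M = 2 * C1dist (H (Suc n)) (H n) + 2 * C1dist (H (Suc (n - 1))) (H (n - 1))"
  have nn: "0 \<le> C1dist (H (Suc n)) (H n)" "0 \<le> C1dist (H (Suc (n - 1))) (H (n - 1))"
    using C1dist_nonneg H by auto
  \<comment> \<open>Within distance \<open>r\<close> the parameter stays in the piece of
    \<open>s0\<close>, or in the two adjacent pieces if \<open>s0\<close> is an integer.\<close>
  define r where "r = (if s0 = real n then 1 else min (s0 - real n) (real n + 1 - s0))"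
  have r: "r > 0" using n by (auto simp: r_def)
  have "\<forall>\<^sub>F t in F. dist (\<sigma> t) s0 < r" using tendstoD[OF \<sigma>(1) r] .
  then have "\<forall>\<^sub>F t in F. norm (C1dist (interp H (\<sigma> t)) (interp H s0)) \<le> \<bar>\<sigma> t - s0\<bar> * M"
    using \<sigma>(2)
  proof eventually_elim
    case (elim t)
    have "C1dist (interp H (\<sigma> t)) (interp H s0) \<le> \<bar>\<sigma> t - s0\<bar> * M"
    proof (cases "\<sigma> t \<ge> real n")
      case True
      have "\<sigma> t \<le> real n + 1" using elim(1) n by (auto simp: r_def dist_real_def split: if_splits)
      from interp_C1dist[OF H True this n(1)] n
      have "C1dist (interp H (\<sigma> t)) (interp H s0) \<le> \<bar>\<sigma> t - s0\<bar> * (2 * C1dist (H (Suc n)) (H n))" by simp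
      also have "\<dots> \<le> \<bar>\<sigma> t - s0\<bar> * M" using nn by (intro mult_left_mono) (auto simp: M_def)
      finally show ?thesis .
    next
      case False
      then have s0n: "s0 = real n" using elim(1) by (auto simp: r_def dist_real_def split: if_splits)
      have n1: "n \<ge> 1" using False elim(2) by (cases n) auto
      have "\<sigma> t \<ge> real (n - 1)" using elim(1) s0n n1 by (auto simp: r_def dist_real_def of_nat_diff)
      from interp_C1dist[OF H this, of s0] False n1 s0n
      have "C1dist (interp H (\<sigma> t)) (interp H s0) \<le> \<bar>\<sigma> t - s0\<bar> * (2 * C1dist (H (Suc (n - 1))) (H (n - 1)))"
        by (simp add: of_nat_diff)
      also have "\<dots> \<le> \<bar>\<sigma> t - s0\<bar> * M" using nn by (intro mult_left_mono) (auto simp: M_def)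
      finally show ?thesis .
    qed
    then show ?case using C1dist_nonneg[OF diff1p_interp(1)[OF H] diff1p_interp(1)[OF H]] by simp
  qed
  moreover have "((\<lambda>t. \<bar>\<sigma> t - s0\<bar> * M) \<longlongrightarrow> 0) F"
  proof -
    have "((\<lambda>t. \<bar>\<sigma> t - s0\<bar> * M) \<longlongrightarrow> \<bar>s0 - s0\<bar> * M) F"
      by (intro tendsto_intros \<sigma>(1))
    then show ?thesis by simp
  qed
  ultimately show ?thesis by (rule Lim_null_comparison)
qed

text \<open>Almost invariance passes from the generators to the group, and from the sequence to the
  path because the two maps joined at a parameter share the same \<open>e\<close>. The fixed points
  and the endpoint derivatives are preserved by convex combination.\<close>

lemma conjugating_path_of_sequence:
  assumes H: "\<And>n. diff1p (H n)"
    and S: "\<And>g. g \<in> S \<Longrightarrow> diff1p g"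
    and q: "\<And>g e. g \<in> S \<Longrightarrow> e > 0 \<Longrightarrow> \<forall>\<^sub>F n in sequentially. quasi_inv (H n) g e"
    and fx: "\<And>n x. x \<in> {0..1} \<Longrightarrow> f x = x \<Longrightarrow> H n x = x"
    and D01: "\<And>n. D (H n) 0 = 1" "\<And>n. D (H n) 1 = 1"
  shows "(\<exists>P. C1_path P \<and>
            (\<forall>t\<in>{0..<1}. supp (P t) \<subseteq> supp f \<and> D (P t) 0 = 1 \<and> D (P t) 1 = 1) \<and>
            (\<forall>g\<in>gen_group S. ((\<lambda>t. C1dist (conj (P t) g) id) \<longlongrightarrow> 0) (at_left 1)))
         \<and> C1_close_to_id (gen_group S)"
proof
  note q' = quasi_inv_gen_group[where F = sequentially, OF H S q]
  show "C1_close_to_id (gen_group S)"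
    unfolding C1_close_to_id_def
  proof (intro exI conjI allI ballI)
    show "(\<lambda>n. C1dist (conj (H n) g) id) \<longlonglongrightarrow> 0" if "g \<in> gen_group S" for g
      using q'[OF _ _ _ that] by (intro quasi_inv_C1dist_tendsto) (auto simp: H)
  qed (rule H)
  \<comment> \<open>The map \<open>t / (1 - t)\<close> carries \<open>{0..<1}\<close> increasingly
    onto the nonnegative reals, so \<open>t\<close> tending to 1 runs through the whole
    sequence.\<close>
  define P where "P = (\<lambda>t. interp H (t / (1 - t)))"
  have P: "diff1p (P t)" for t unfolding P_def by (rule diff1p_interp(1)[OF H])
  show "\<exists>P. C1_path P \<and>
            (\<forall>t\<in>{0..<1}. supp (P t) \<subseteq> supp f \<and> D (P t) 0 = 1 \<and> D (P t) 1 = 1) \<and>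
            (\<forall>g\<in>gen_group S. ((\<lambda>t. C1dist (conj (P t) g) id) \<longlongrightarrow> 0) (at_left 1))"
  proof (intro exI[of _ P] conjI ballI)
    show "C1_path P"
      unfolding C1_path_def
    proof (intro conjI ballI P)
      fix t0 :: real assume t0: "t0 \<in> {0..<1}"
      show "((\<lambda>t. C1dist (P t) (P t0)) \<longlongrightarrow> 0) (at t0 within {0..<1})"
        unfolding P_def
      proof (rule interp_continuous[OF H])
        show "((\<lambda>t. t / (1 - t)) \<longlongrightarrow> t0 / (1 - t0)) (at t0 within {0..<1})"
          using t0 by (intro tendsto_intros) auto
        show "\<forall>\<^sub>F t in at t0 within {0..<1}. 0 \<le> t / (1 - t)"
          unfolding eventually_at_filter by (intro always_eventually) auto
      qed (use t0 in auto)
    qed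
  next
    fix t :: real
    have "P t x = x" if "x \<in> {0..1}" "f x = x" for x
      using fx[OF that] by (simp add: P_def interp_def algebra_simps)
    then have "{x \<in> {0..1}. P t x \<noteq> x} \<subseteq> {x \<in> {0..1}. f x \<noteq> x}" by blast
    then show "supp (P t) \<subseteq> supp f" unfolding supp_def by (rule closure_mono)
    show "D (P t) 0 = 1" "D (P t) 1 = 1"
      using diff1p_interp(2)[OF H, of 0] diff1p_interp(2)[OF H, of 1] D01 by (auto simp: P_def)
  next
    fix g assume g: "g \<in> gen_group S"
    have dg: "diff1p g" and qg: "\<And>e. e > 0 \<Longrightarrow> \<forall>\<^sub>F n in sequentially. quasi_inv (H n) g e"
      using q'[OF _ _ _ g] by auto
    show "((\<lambda>t. C1dist (conj (P t) g) id) \<longlongrightarrow> 0) (at_left 1)"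
    proof (rule quasi_inv_C1dist_tendsto[OF _ dg])
      fix e :: real assume "e > 0"
      from qg[OF this] obtain N where N: "\<And>n. n \<ge> N \<Longrightarrow> quasi_inv (H n) g e"
        by (auto simp: eventually_sequentially)
      have "\<forall>\<^sub>F t::real in at_left 1. real N \<le> t / (1 - t)"
      proof -
        have "real N / (real N + 1) < 1" by simp
        then have "\<forall>\<^sub>F t::real in at_left 1. t \<in> {real N / (real N + 1)<..<1}"
          by (rule eventually_at_left_real)
        then show ?thesis by eventually_elim (auto simp: field_simps)
      qed
      then show "\<forall>\<^sub>F t in at_left 1. quasi_inv (P t) g e"
      proof eventually_elim
        case (elim t)
        \<comment> \<open>Both interpolated maps then have index at least \<open>N\<close>.\<close>
        then have "N \<le> nat \<lfloor>t / (1 - t)\<rfloor>" by linarith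
        then show ?case unfolding P_def interp_def
          using frac_lt_1[of "t / (1 - t)"] by (intro quasi_inv_convex H dg N) auto
      qed
    qed (simp add: P)
  qed
qed

section \<open>Averaging along orbits\<close>

lemma diff1p_funpow: "diff1p f \<Longrightarrow> diff1p (f ^^ n)"
  by (induction n) (auto intro: diff1p_comp(1) simp only: funpow.simps diff1p_id)

lemma D_funpow_Suc:
  assumes "diff1p f" "x \<in> {0..1}"
  shows "D (f ^^ Suc n) x = D f ((f ^^ n) x) * D (f ^^ n) x"
  unfolding funpow.simps by (rule diff1p_comp(2)[OF assms(1) diff1p_funpow[OF assms(1)] assms(2)])

section \<open>Growth of derivatives along orbits\<close>

lemma no_hyperbolic_dinv:
  assumes f: "diff1p f" and "no_hyperbolic_fixed_points f"
  shows "no_hyperbolic_fixed_points (dinv f)"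
  unfolding no_hyperbolic_fixed_points_def
proof (intro ballI impI)
  fix x :: real assume x: "x \<in> {0..1}" "dinv f x = x"
  then have "f x = x" using dinv_right[OF f, of x] by simp
  then show "D (dinv f) x = 1" using assms x diff1p_dinv(2)[OF f x(1)] unfolding no_hyperbolic_fixed_points_def by auto
qed

text \<open>As \<open>f\<close> is increasing, the sign of \<open>f x - x\<close> persists along the
  orbit. The orbit is monotone and displacements add without cancellation.\<close>

lemma funpow_displacement:
  assumes f: "diff1p f"
  shows "\<bar>(f ^^ Suc n) x - x\<bar> = \<bar>f ((f ^^ n) x) - (f ^^ n) x\<bar> + \<bar>(f ^^ n) x - x\<bar>"
proof (cases "x \<le> f x")
  case True
  have "(f ^^ n) x \<le> f ((f ^^ n) x) \<and> x \<le> (f ^^ n) x" for n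
    using True diff1p_mono[OF f] by (induction n) auto
  from this[of n] show ?thesis by auto
next
  case False
  have "(f ^^ n) x \<ge> f ((f ^^ n) x) \<and> x \<ge> (f ^^ n) x" for n
    using False diff1p_mono[OF f] by (induction n) auto
  from this[of n] show ?thesis by auto
qed

text \<open>\<open>D f\<close> exceeds \<open>exp e\<close> only where points are moved by a definite amount, and the total
  displacement of a monotone orbit in \<open>[0, 1]\<close> is at most 1.\<close>

lemma D_funpow_subexponential:
  assumes f: "diff1p f" and nh: "no_hyperbolic_fixed_points f" and e: "e > 0"
  obtains C where "C > 0" "\<And>n x. x \<in> {0..1} \<Longrightarrow> D (f ^^ n) x \<le> C * exp (e * real n)"
proof -
  define Z where "Z = {x \<in> {0..1}. exp e \<le> D f x}"
  have "compact Z"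
  proof -
    have "Z = {0..1} \<inter> (D f) -` {exp e..}" by (auto simp: Z_def)
    then have "closed Z"
      using continuous_closed_preimage[OF diff1p_D_continuous[OF f], of "{exp e..}"] by simp
    moreover have "bounded Z" by (rule bounded_subset[of "{0..1}"]) (auto simp: Z_def)
    ultimately show ?thesis by (simp add: compact_eq_bounded_closed)
  qed
  \<comment> \<open>Fixed points have derivative 1, which is less than \<open>exp e\<close>, so the
    compact set \<open>Z\<close> contains none and the displacement has a positive minimum on
    it.\<close>
  have "\<exists>d>0. \<forall>x\<in>Z. d \<le> \<bar>f x - x\<bar>"
  proof (cases "Z = {}")
    case False
    have "continuous_on Z (\<lambda>x. \<bar>f x - x\<bar>)"
      by (intro continuous_intros continuous_on_subset[OF diff1p_continuous[OF f]]) (auto simp: Z_def)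
    from continuous_attains_inf[OF \<open>compact Z\<close> False this]
    obtain z where z: "z \<in> Z" "\<forall>x\<in>Z. \<bar>f z - z\<bar> \<le> \<bar>f x - x\<bar>" by blast
    have "f z \<noteq> z" using z(1) nh e by (auto simp: Z_def no_hyperbolic_fixed_points_def)
    then show ?thesis using z(2) by (intro exI[of _ "\<bar>f z - z\<bar>"]) auto
  qed (auto intro: exI[of _ 1])
  then obtain d where d: "d > 0" "\<And>x. x \<in> Z \<Longrightarrow> d \<le> \<bar>f x - x\<bar>" by blast
  obtain L where L: "\<And>x. x \<in> {0..1} \<Longrightarrow> D f x \<le> L"
    using continuous_attains_sup[OF compact_Icc _ diff1p_D_continuous[OF f]] by force
  \<comment> \<open>On \<open>Z\<close> the displacement is at least \<open>d\<close>, so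
    \<open>A\<close> times the displacement absorbs the largest possible
    \<open>ln (D f y)\<close>.\<close>
  define A where "A = \<bar>ln L\<bar> / d"
  have A: "A \<ge> 0" using d by (simp add: A_def)
  have step: "D f y \<le> exp (e + A * \<bar>f y - y\<bar>)" if y: "y \<in> {0..1}" for y
  proof (cases "y \<in> Z")
    case True
    have "0 < L" using L[OF y] diff1p_deriv(2)[OF f y] by linarith
    then have "D f y \<le> exp (ln L)" using L[OF y] by simp
    also have "ln L \<le> A * d" using d by (simp add: A_def)
    also have "A * d \<le> e + A * \<bar>f y - y\<bar>" using mult_left_mono[OF d(2)[OF True] A] e by linarith
    finally show ?thesis by simp
  next
    case False
    then have "D f y \<le> exp e" using y by (auto simp: Z_def)
    also have "\<dots> \<le> exp (e + A * \<bar>f y - y\<bar>)" using A by simp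
    finally show ?thesis .
  qed
  \<comment> \<open>Multiplying the one-step bounds along the orbit sums the displacements to the
    total displacement, which is at most 1.\<close>
  have main: "D (f ^^ n) x \<le> exp (e * real n + A * \<bar>(f ^^ n) x - x\<bar>)" if x: "x \<in> {0..1}" for n x
  proof (induction n)
    case 0
    show ?case using D_id[OF x] by (simp add: id_def[symmetric])
  next
    case (Suc n)
    have y: "(f ^^ n) x \<in> {0..1}" using diff1p_in[OF diff1p_funpow[OF f] x] .
    have "D (f ^^ Suc n) x \<le> exp (e + A * \<bar>f ((f ^^ n) x) - (f ^^ n) x\<bar>) * exp (e * real n + A * \<bar>(f ^^ n) x - x\<bar>)"
      unfolding D_funpow_Suc[OF f x] using step[OF y] Suc diff1p_deriv(2)[OF diff1p_funpow[OF f] x, of n]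
      by (intro mult_mono) auto
    also have "\<dots> = exp (e * real (Suc n) + A * \<bar>(f ^^ Suc n) x - x\<bar>)"
      unfolding funpow_displacement[OF f] exp_add[symmetric] by (simp add: algebra_simps)
    finally show ?case .
  qed
  show thesis
  proof (rule that[of "exp A"])
    fix n x assume x: "x \<in> {0..1::real}"
    have "(f ^^ n) x \<in> {0..1}" using diff1p_in[OF diff1p_funpow[OF f] x] .
    then have "\<bar>(f ^^ n) x - x\<bar> \<le> 1" using x by auto
    then have "A * \<bar>(f ^^ n) x - x\<bar> \<le> A" using A mult_left_mono by fastforce
    then have "exp (e * real n + A * \<bar>(f ^^ n) x - x\<bar>) \<le> exp (A + e * real n)" by simp
    then have "D (f ^^ n) x \<le> exp (A + e * real n)" using main[OF x, of n] by (rule order_trans[rotated])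
    then show "D (f ^^ n) x \<le> exp A * exp (e * real n)" by (simp only: exp_add)
  qed simp
qed

text \<open>The majorants give uniform convergence of the differentiated series, hence termwise
  differentiation and a continuous derivative. Weights of total 1 preserve the common fixed points,
  in particular the endpoints.\<close>

lemma diff1p_series:
  assumes p: "\<And>n. p n > 0" "p sums 1"
    and w: "\<And>n. diff1p (w n)"
    and M: "\<And>n x. x \<in> {0..1} \<Longrightarrow> D (w n) x \<le> M n" "summable (\<lambda>n. p n * M n)"
  shows "diff1p (\<lambda>x. \<Sum>n. p n * w n x)"
    and "x \<in> {0..1} \<Longrightarrow> (\<lambda>n. p n * D (w n) x) sums D (\<lambda>x. \<Sum>n. p n * w n x) x"
proof -
  let ?H = "\<lambda>x. \<Sum>n. p n * w n x" and ?d = "\<lambda>x. \<Sum>n. p n * D (w n) x"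
  have bound: "norm (p n * D (w n) x) \<le> p n * M n" if "x \<in> {0..1}" for n x
    using M(1)[OF that, of n] p(1)[of n] diff1p_deriv(2)[OF w[of n] that] by (simp add: abs_mult mult_left_mono)
  have unif: "uniform_limit {0..1} (\<lambda>n x. \<Sum>i<n. p i * D (w i) x) ?d sequentially"
    by (rule Weierstrass_m_test[OF bound M(2)])
  have sm: "summable (\<lambda>n. p n * D (w n) x)" if "x \<in> {0..1}" for x
    by (rule summable_comparison_test[OF _ M(2)]) (use bound[OF that] in blast)
  have "\<exists>h. \<forall>x\<in>{0..1}. (\<lambda>n. p n * w n x) sums h x \<and> (h has_real_derivative ?d x) (at x within {0..1})"
  proof (rule has_field_derivative_series[OF _ _ unif, of _ 0])
    show "((\<lambda>x. p n * w n x) has_real_derivative p n * D (w n) x) (at x within {0..1})" if "x \<in> {0..1}" for n x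
      by (intro DERIV_cmult diff1p_deriv(1) w that)
    show "summable (\<lambda>n. p n * w n 0)" using diff1p_0[OF w] by simp
  qed auto
  then obtain h where h: "\<And>x. x \<in> {0..1} \<Longrightarrow> (\<lambda>n. p n * w n x) sums h x"
    "\<And>x. x \<in> {0..1} \<Longrightarrow> (h has_real_derivative ?d x) (at x within {0..1})"
    by blast
  have der: "(?H has_real_derivative ?d x) (at x within {0..1})" if "x \<in> {0..1}" for x
    by (rule has_field_derivative_transform_within[OF h(2)[OF that] zero_less_one that]) (rule sums_unique[OF h(1)])
  have fixed: "?H x = x" if "\<And>n. w n x = x" for x
    using sums_unique[OF sums_mult2[OF p(2), of x]] that by simp
  show "diff1p ?H"
  proof (rule diff1pI[OF _ _ _ der])
    show "?H x = x" if "x \<notin> {0..1}" for x using fixed diff1p_outside[OF w that] by blast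
    show "?d x > 0" if "x \<in> {0..1}" for x
      using p(1) diff1p_deriv(2)[OF w that] by (intro suminf_pos sm that) auto
    show "continuous_on {0..1} ?d"
      by (rule uniform_limit_theorem[OF _ unif])
        (auto intro!: always_eventually continuous_intros diff1p_D_continuous w)
    show "?H 0 = 0" by (rule fixed) (rule diff1p_0[OF w])
    show "?H 1 = 1" by (rule fixed) (rule diff1p_1[OF w])
  qed
  show "(\<lambda>n. p n * D (w n) x) sums D ?H x" if "x \<in> {0..1}"
    using D_eq[OF der[OF that] that] sm[OF that] summable_sums by metis
qed

text \<open>The average of the maps \<open>k \<circ> f\<^sup>i\<close>, \<open>i \<in> \<int>\<close>, with weight proportional to \<open>q ^ i\<close> for
  \<open>i \<ge> 0\<close> and \<open>q ^ (- i - 1)\<close> for \<open>i < 0\<close>. Neighbouring weights have ratio \<open>q\<close>, \<open>1\<close> or \<open>1 / q\<close>,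
  hence the density of the average is changed by \<open>f\<close> by a factor in \<open>[q, 1 / q]\<close>.\<close>

definition orbit_average :: "real \<Rightarrow> (real \<Rightarrow> real) \<Rightarrow> (real \<Rightarrow> real) \<Rightarrow> real \<Rightarrow> real" where
  "orbit_average q f k = (\<lambda>x. \<Sum>n. (1 - q) * q ^ n *
     ((1 - 1/2) * (k \<circ> f ^^ n) x + 1/2 * (k \<circ> dinv f ^^ Suc n) x))"

text \<open>Iterates in both time directions are allowed growth rate \<open>d / 2\<close>. Against
  weights decaying at rate \<open>d\<close> this leaves a geometric decay at rate
  \<open>d / 2\<close>.\<close>

lemma D_orbit_bound:
  assumes f: "diff1p f" and nh: "no_hyperbolic_fixed_points f" and d: "d > 0"
  obtains C where "C > 0"
    "\<And>n x. x \<in> {0..1} \<Longrightarrow> exp (- d) ^ n * (D (f ^^ n) x + D (dinv f ^^ Suc n) x) \<le> C * exp (- d / 2) ^ n"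
proof -
  have d2: "d / 2 > 0" using d by simp
  obtain C where C: "C > 0" "\<And>n x. x \<in> {0..1} \<Longrightarrow> D (f ^^ n) x \<le> C * exp (d / 2 * real n)"
    using D_funpow_subexponential[OF f nh d2] by metis
  obtain C' where C': "C' > 0" "\<And>n x. x \<in> {0..1} \<Longrightarrow> D (dinv f ^^ n) x \<le> C' * exp (d / 2 * real n)"
    using D_funpow_subexponential[OF diff1p_dinv(1)[OF f] no_hyperbolic_dinv[OF f nh] d2] by metis
  show thesis
  proof (rule that[of "C + C' * exp (d / 2)"])
    fix n and x :: real assume x: "x \<in> {0..1}"
    have "D (f ^^ n) x + D (dinv f ^^ Suc n) x \<le> C * exp (d / 2 * real n) + C' * exp (d / 2 * real (Suc n))"
      using C(2)[OF x, of n] C'(2)[OF x, of "Suc n"] by (rule add_mono)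
    also have "\<dots> = (C + C' * exp (d / 2)) * exp (d / 2 * real n)"
      by (simp add: algebra_simps exp_add[symmetric])
    finally have "exp (- d) ^ n * (D (f ^^ n) x + D (dinv f ^^ Suc n) x) \<le>
        exp (- d) ^ n * ((C + C' * exp (d / 2)) * exp (d / 2 * real n))"
      by (intro mult_left_mono) auto
    also have "\<dots> = (C + C' * exp (d / 2)) * (exp (- d) ^ n * exp (d / 2) ^ n)"
      by (simp add: exp_of_nat_mult[symmetric] mult.commute)
    also have "exp (- d) ^ n * exp (d / 2) ^ n = exp (- d / 2) ^ n"
      by (simp add: power_mult_distrib[symmetric] exp_add[symmetric])
    finally show "exp (- d) ^ n * (D (f ^^ n) x + D (dinv f ^^ Suc n) x) \<le> (C + C' * exp (d / 2)) * exp (- d / 2) ^ n" .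
  qed (use C C' in \<open>simp add: add_pos_pos\<close>)
qed

text \<open>The derivative of each averaged map is at most the maximum of \<open>D k\<close> times
  the orbit derivatives, so \<open>D_orbit_bound\<close> supplies the majorants. The two-sided orbit
  is indexed by pairing \<open>n\<close> with \<open>- n - 1\<close>.\<close>

lemma orbit_average:
  assumes f: "diff1p f" and nh: "no_hyperbolic_fixed_points f" and k: "diff1p k" and d: "d > 0"
  shows "diff1p (orbit_average (exp (- d)) f k)"
    and "x \<in> {0..1} \<Longrightarrow> (\<lambda>n. (1 - exp (- d)) / 2 * (exp (- d) ^ n *
           (D k ((f ^^ n) x) * D (f ^^ n) x + D k ((dinv f ^^ Suc n) x) * D (dinv f ^^ Suc n) x)))
         sums D (orbit_average (exp (- d)) f k) x"
proof -
  let ?q = "exp (- d)" and ?g = "dinv f"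
  let ?w = "\<lambda>n x. (1 - 1/2) * (k \<circ> f ^^ n) x + 1/2 * (k \<circ> ?g ^^ Suc n) x"
  have g: "diff1p ?g" using diff1p_dinv(1)[OF f] .
  have fn: "diff1p (f ^^ n)" "diff1p (?g ^^ n)" for n using diff1p_funpow f g by auto
  note kf = diff1p_comp[OF k fn(1)] diff1p_comp[OF k fn(2)]
  have q: "0 < ?q" "?q < 1" using d by auto
  obtain C where C: "C > 0"
    "\<And>n x. x \<in> {0..1} \<Longrightarrow> ?q ^ n * (D (f ^^ n) x + D (?g ^^ Suc n) x) \<le> C * exp (- d / 2) ^ n"
    using D_orbit_bound[OF f nh d] by metis
  obtain L where L: "\<And>x. x \<in> {0..1} \<Longrightarrow> D k x \<le> L"
    using continuous_attains_sup[OF compact_Icc _ diff1p_D_continuous[OF k]] by force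
  have L0: "L > 0" using L[of 0] diff1p_deriv(2)[OF k, of 0] by auto
  have w: "diff1p (?w n)" for n by (rule diff1p_convex(1)[OF kf(1) kf(3)]) auto
  have Dw: "D (?w n) x = (D k ((f ^^ n) x) * D (f ^^ n) x + D k ((?g ^^ Suc n) x) * D (?g ^^ Suc n) x) / 2"
    if x: "x \<in> {0..1}" for n x
    using diff1p_convex(2)[OF kf(1)[of n] kf(3)[of "Suc n"] _ _ x, of "1/2"] kf(2)[OF x, of n] kf(4)[OF x, of "Suc n"]
    by (simp only: field_simps) simp
  have Dwb: "D (?w n) x \<le> L * (D (f ^^ n) x + D (?g ^^ Suc n) x)" if x: "x \<in> {0..1}" for n x
  proof -
    have a: "D k ((f ^^ n) x) * D (f ^^ n) x \<le> L * D (f ^^ n) x"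
      using L[OF diff1p_in[OF fn(1) x]] diff1p_deriv(2)[OF fn(1) x] by (intro mult_right_mono) (auto simp: less_imp_le)
    have b: "D k ((?g ^^ Suc n) x) * D (?g ^^ Suc n) x \<le> L * D (?g ^^ Suc n) x"
      by (rule mult_right_mono[OF L[OF diff1p_in[OF fn(2) x]] less_imp_le[OF diff1p_deriv(2)[OF fn(2) x]]])
    have "0 < L * D (f ^^ n) x" "0 < L * D (?g ^^ Suc n) x"
      by (rule mult_pos_pos[OF L0 diff1p_deriv(2)[OF fn(1) x]], rule mult_pos_pos[OF L0 diff1p_deriv(2)[OF fn(2) x]])
    moreover have "(X + Y) / 2 \<le> X' + Y'" if "0 < X'" "0 < Y'" "X \<le> X'" "Y \<le> Y'" for X Y X' Y' :: real
      using that by simp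
    ultimately show ?thesis unfolding Dw[OF x] distrib_left using a b by blast
  qed
  \<comment> \<open>The division by \<open>exp (- d) ^ n\<close> undoes the weight that
    \<open>diff1p_series\<close> multiplies in, so that the products form a geometric
    series.\<close>
  define M where "M = (\<lambda>n. L * (C * exp (- d / 2) ^ n) / ?q ^ n)"
  have M: "D (?w n) x \<le> M n" if x: "x \<in> {0..1}" for n x
  proof -
    have "D (f ^^ n) x + D (?g ^^ Suc n) x \<le> C * exp (- d / 2) ^ n / ?q ^ n"
      using C(2)[OF x, of n] q by (simp only: pos_le_divide_eq zero_less_power mult.commute)
    from mult_left_mono[OF this less_imp_le[OF L0]] Dwb[OF x, of n]
    show ?thesis by (simp only: M_def times_divide_eq_right)
  qed
  have p: "(\<lambda>n. (1 - ?q) * ?q ^ n) sums 1"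
    using sums_mult[OF geometric_sums[of ?q], of "1 - ?q"] q by simp
  have sm: "summable (\<lambda>n. (1 - ?q) * ?q ^ n * M n)"
  proof -
    have "(\<lambda>n. (1 - ?q) * ?q ^ n * M n) = (\<lambda>n. ((1 - ?q) * L * C) * exp (- d / 2) ^ n)"
      using q by (auto simp: M_def fun_eq_iff)
    moreover have "summable (\<lambda>n. exp (- d / 2) ^ n)" using d by (intro summable_geometric) auto
    ultimately show ?thesis by (simp add: summable_mult)
  qed
  have p0: "(1 - ?q) * ?q ^ n > 0" for n using q by simp
  show "diff1p (orbit_average ?q f k)" unfolding orbit_average_def
    by (rule diff1p_series(1)[OF p0 p w _ sm]) (rule M)
  show "(\<lambda>n. (1 - ?q) / 2 * (?q ^ n *
           (D k ((f ^^ n) x) * D (f ^^ n) x + D k ((?g ^^ Suc n) x) * D (?g ^^ Suc n) x)))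
         sums D (orbit_average ?q f k) x" if x: "x \<in> {0..1}"
  proof -
    have "(\<lambda>n. (1 - ?q) * ?q ^ n * D (?w n) x) = (\<lambda>n. (1 - ?q) / 2 * (?q ^ n *
           (D k ((f ^^ n) x) * D (f ^^ n) x + D k ((?g ^^ Suc n) x) * D (?g ^^ Suc n) x)))"
      unfolding Dw[OF x] by (rule ext) (simp only: times_divide_eq_left times_divide_eq_right mult.assoc)
    moreover have "(\<lambda>n. (1 - ?q) * ?q ^ n * D (?w n) x) sums D (orbit_average ?q f k) x"
      unfolding orbit_average_def by (rule diff1p_series(2)[OF p0 p w _ sm x]) (rule M)
    ultimately show ?thesis by simp
  qed
qed

lemma orbit_average_fixed:
  assumes f: "diff1p f" and d: "d > 0" and x: "f x = x" and k: "k x = x"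
  shows "orbit_average (exp (- d)) f k x = x"
proof -
  have gx: "dinv f x = x" using dinv_left[OF f, of x] x by simp
  have n: "(f ^^ n) x = x" "(dinv f ^^ n) x = x" for n using x gx by (induction n) auto
  have "(\<lambda>n. (1 - exp (- d)) * exp (- d) ^ n) sums 1"
    using sums_mult[OF geometric_sums[of "exp (- d)"], of "1 - exp (- d)"] d by simp
  from sums_unique[OF sums_mult2[OF this, of x]] show ?thesis
    unfolding orbit_average_def o_apply n k by simp
qed

text \<open>Pullback by \<open>f\<close> shifts the orbit by one place: the forward half loses its
  first term and the backward half gains it. Both densities are thus expressed by the two sums
  \<open>A\<close> and \<open>B\<close> and the common term \<open>a 0 = b 0\<close>.\<close>

lemma orbit_average_quasi_inv:
  assumes f: "diff1p f" and nh: "no_hyperbolic_fixed_points f" and k: "diff1p k" and d: "d > 0"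
  shows "quasi_inv (orbit_average (exp (- d)) f k) f d"
  unfolding quasi_inv_def
proof
  let ?q = "exp (- d)" and ?g = "dinv f" and ?H = "orbit_average (exp (- d)) f k"
  fix x :: real assume x: "x \<in> {0..1}"
  have g: "diff1p ?g" using diff1p_dinv(1)[OF f] .
  have fn: "diff1p (f ^^ n)" "diff1p (?g ^^ n)" for n using diff1p_funpow f g by auto
  have fx: "f x \<in> {0..1}" using diff1p_in[OF f x] .
  have q: "0 < ?q" "?q < 1" using d by auto
  define a b where "a = (\<lambda>n. D k ((f ^^ n) x) * D (f ^^ n) x)" and "b = (\<lambda>n. D k ((?g ^^ n) x) * D (?g ^^ n) x)"
  have a_pos: "a n > 0" and b_pos: "b n > 0" for n
    unfolding a_def b_def using diff1p_deriv(2)[OF k diff1p_in[OF fn(1) x]] diff1p_deriv(2)[OF fn(1) x]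
      diff1p_deriv(2)[OF k diff1p_in[OF fn(2) x]] diff1p_deriv(2)[OF fn(2) x] by simp_all
  have ab0: "a 0 = b 0" by (simp add: a_def b_def)
  have 1: "(\<lambda>n. (1 - ?q) / 2 * (?q ^ n * (a n + b (Suc n)))) sums D ?H x"
    using orbit_average(2)[OF f nh k d x] unfolding a_def b_def .
  have sh_a: "D k ((f ^^ n) (f x)) * D (f ^^ n) (f x) * D f x = a (Suc n)" for n
    using diff1p_comp(2)[OF fn(1) f x, of n] by (simp add: a_def funpow_Suc_right del: funpow.simps)
  have sh_b: "D k ((?g ^^ Suc n) (f x)) * D (?g ^^ Suc n) (f x) * D f x = b n" for n
  proof -
    have "?g ^^ Suc n \<circ> f = ?g ^^ n" by (auto simp: fun_eq_iff funpow_Suc_right dinv_left[OF f] simp del: funpow.simps)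
    then show ?thesis using diff1p_comp(2)[OF fn(2) f x, of "Suc n"]
      by (metis b_def comp_apply mult.assoc)
  qed
  have 2: "(\<lambda>n. (1 - ?q) / 2 * (?q ^ n * (a (Suc n) + b n))) sums (D ?H (f x) * D f x)"
    using sums_mult2[OF orbit_average(2)[OF f nh k d fx], of "D f x"]
    by (simp only: mult.assoc distrib_right sh_a[unfolded mult.assoc] sh_b[unfolded mult.assoc])
  define c where "c = (1 - ?q) / 2"
  have c: "c > 0" using q by (simp add: c_def)
  have s1: "(\<lambda>n. ?q ^ n * (a n + b (Suc n))) sums (D ?H x / c)"
    using sums_divide[OF 1, of c] c by (simp only: c_def[symmetric]) simp
  have s2: "(\<lambda>n. ?q ^ n * (a (Suc n) + b n)) sums (D ?H (f x) * D f x / c)"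
    using sums_divide[OF 2, of c] c by (simp only: c_def[symmetric]) simp
  \<comment> \<open>All terms are positive, so each half converges separately by comparison with the
    full series.\<close>
  have sa: "summable (\<lambda>n. ?q ^ n * a n)"
    by (rule summable_comparison_test[OF _ sums_summable[OF s1]])
      (use a_pos b_pos q in \<open>auto intro!: exI[of _ 0] mult_left_mono simp: abs_mult less_imp_le\<close>)
  have sb: "summable (\<lambda>n. ?q ^ n * b n)"
    by (rule summable_comparison_test[OF _ sums_summable[OF s2]])
      (use a_pos b_pos q in \<open>auto intro!: exI[of _ 0] mult_left_mono simp: abs_mult less_imp_le\<close>)
  define A B where "A = (\<Sum>n. ?q ^ n * a n)" and "B = (\<Sum>n. ?q ^ n * b n)"
  have shift: "(\<lambda>n. ?q ^ n * u (Suc n)) sums (((\<Sum>n. ?q ^ n * u n) - u 0) / ?q)"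
    if "summable (\<lambda>n. ?q ^ n * u n)" for u :: "nat \<Rightarrow> real"
  proof -
    have "(\<lambda>n. ?q ^ Suc n * u (Suc n)) sums ((\<Sum>n. ?q ^ n * u n) - u 0)"
      using summable_sums[OF that] by (subst sums_Suc_iff) simp
    from sums_divide[OF this, of ?q] show ?thesis using q by (simp del: exp_gt_zero)
  qed
  have "(\<lambda>n. ?q ^ n * (a n + b (Suc n))) sums (A + (B - b 0) / ?q)"
    using sums_add[OF summable_sums[OF sa] shift[OF sb]] by (simp add: A_def B_def distrib_left)
  then have V: "D ?H x = c * (A + (B - b 0) / ?q)" using sums_unique2[OF s1] c by (simp add: field_simps)
  have "(\<lambda>n. ?q ^ n * (a (Suc n) + b n)) sums ((A - a 0) / ?q + B)"
    using sums_add[OF shift[OF sa] summable_sums[OF sb]] by (simp add: A_def B_def distrib_left)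
  then have V': "D ?H (f x) * D f x = c * ((A - a 0) / ?q + B)" using sums_unique2[OF s2] c by (simp add: field_simps)
  have A: "A \<ge> a 0" unfolding A_def
    using sum_le_suminf[OF sa, of "{0}"] a_pos by (simp add: less_imp_le)
  have B: "B \<ge> b 0" unfolding B_def
    using sum_le_suminf[OF sb, of "{0}"] b_pos by (simp add: less_imp_le)
  \<comment> \<open>Clearing denominators reduces this to the nonnegative expression below.
    Exchanging the roles of \<open>A\<close> and \<open>B\<close> yields both required
    bounds.\<close>
  have gen: "?q * (X + (Y - z) / ?q) \<le> (X - z) / ?q + Y" if "X \<ge> z" "z > 0" for X Y z
  proof -
    have "0 \<le> (X - z) * (1 - ?q * ?q) + z * ?q * (1 - ?q)"
      using that q by (intro add_nonneg_nonneg mult_nonneg_nonneg) (auto simp: mult_le_one)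
    then have "(?q * X + (Y - z)) * ?q \<le> (X - z) + ?q * Y" by (simp add: algebra_simps)
    then have "?q * X + (Y - z) \<le> ((X - z) + ?q * Y) / ?q" using q(1) by (subst pos_le_divide_eq)
    moreover have "?q * (X + (Y - z) / ?q) = ?q * X + (Y - z)" using q by (simp add: field_simps)
    moreover have "((X - z) + ?q * Y) / ?q = (X - z) / ?q + Y" using q by (simp add: field_simps)
    ultimately show ?thesis by linarith
  qed
  have lo: "?q * D ?H x \<le> D ?H (f x) * D f x"
    unfolding V V' using mult_left_mono[OF gen[OF A a_pos, of B], of c] c ab0 by (simp add: mult.left_commute)
  have "?q * (D ?H (f x) * D f x) \<le> D ?H x"
    unfolding V V' using mult_left_mono[OF gen[OF B b_pos, of A], of c] c ab0 by (simp add: mult.left_commute add.commute)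
  then have "D ?H (f x) * D f x \<le> exp d * D ?H x" by (simp add: exp_minus field_simps)
  with lo show "exp (- d) * D ?H x \<le> D ?H (f x) * D f x \<and> D ?H (f x) * D f x \<le> exp d * D ?H x" by blast
qed

section \<open>A fundamental domain\<close>

text \<open>At a fixed point that is not hyperbolic all iterates have derivative 1, so the
  derivative of the average is the total weight. At 0 and 1 this gives the required endpoint
  derivatives.\<close>

lemma orbit_average_D_fixed:
  assumes f: "diff1p f" and nh: "no_hyperbolic_fixed_points f" and k: "diff1p k" and d: "d > 0"
    and x: "x \<in> {0..1}" "f x = x" "D k x = 1"
  shows "D (orbit_average (exp (- d)) f k) x = 1"
proof -
  have gx: "dinv f x = x" using dinv_left[OF f, of x] x by simp
  have D1: "D f x = 1" "D (dinv f) x = 1"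
    using nh no_hyperbolic_dinv[OF f nh] x gx by (auto simp: no_hyperbolic_fixed_points_def)
  have n: "(f ^^ n) x = x" "(dinv f ^^ n) x = x" for n using x gx by (induction n) auto
  have "D (f ^^ n) x = 1 \<and> D (dinv f ^^ n) x = 1" for n
  proof (induction n)
    case 0
    show ?case using D_id[OF x(1)] by (simp add: id_def[symmetric])
  next
    case (Suc n)
    then show ?case
      by (simp only: D_funpow_Suc[OF f x(1)] D_funpow_Suc[OF diff1p_dinv(1)[OF f] x(1)] n D1 mult_1)
  qed
  then have "(\<lambda>n. (1 - exp (- d)) / 2 * (exp (- d) ^ n * (1 + 1))) sums D (orbit_average (exp (- d)) f k) x"
    using orbit_average(2)[OF f nh k d x(1)] by (simp only: n x(3) mult_1)
  moreover have "(\<lambda>n. (1 - exp (- d)) / 2 * (exp (- d) ^ n * (1 + 1))) sums 1"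
    using sums_mult[OF geometric_sums[of "exp (- d)"], of "1 - exp (- d)"] d by simp
  ultimately show ?thesis by (rule sums_unique2)
qed

text \<open>The derivative is already determined by the difference quotients inside
  \<open>{a..b}\<close>, which are 1; this works one-sidedly at its ends too.\<close>

lemma D_eq_1:
  assumes h: "diff1p h" and "a < b" "{a..b} \<subseteq> {0..1}" and id: "\<And>x. x \<in> {a..b} \<Longrightarrow> h x = x" and y: "y \<in> {a..b}"
  shows "D h y = 1"
proof -
  have "(h has_real_derivative D h y) (at y within {a..b})"
    using diff1p_deriv(1)[OF h] assms(3) y DERIV_subset by blast
  then have "((\<lambda>x. x) has_real_derivative D h y) (at y within {a..b})"
    by (rule has_field_derivative_transform_within[OF _ zero_less_one y]) (use id in auto)
  then have "((\<lambda>z. (z - y) / (z - y)) \<longlongrightarrow> D h y) (at y within {a..b})"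
    by (simp add: has_field_derivative_iff)
  moreover have "((\<lambda>z. (z - y) / (z - y)) \<longlongrightarrow> 1) (at y within {a..b})"
    by (rule tendsto_eventually) (auto simp: eventually_at_filter)
  moreover have "at y within {a..b} \<noteq> bot"
    using \<open>a < b\<close> y by (auto simp: trivial_limit_within islimpt_Icc)
  ultimately show ?thesis using tendsto_unique by blast
qed

text \<open>Everything outside \<open>{a..b}\<close> is fixed. If an end of the interval were moved,
  its image or its preimage would lie outside and be fixed, contradicting strict monotonicity. The
  derivative at the ends is computed from the outer side.\<close>

lemma supported:
  assumes h: "diff1p h" and ab: "0 < a" "a < b" "b < 1" and s: "supp h \<subseteq> {a..b}"
  shows "x \<le> a \<or> b \<le> x \<Longrightarrow> h x = x"
    and "x \<in> {0..1} \<Longrightarrow> x \<le> a \<or> b \<le> x \<Longrightarrow> D h x = 1"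
    and "x \<in> {a..b} \<Longrightarrow> h x \<in> {a..b}"
proof -
  have out: "h x = x" if "x \<notin> {a..b}" for x
  proof (rule ccontr)
    assume "h x \<noteq> x"
    then have "x \<in> {x \<in> {0..1}. h x \<noteq> x}" using diff1p_outside[OF h] by auto
    then have "x \<in> supp h" unfolding supp_def by (rule subsetD[OF closure_subset])
    then show False using s that by blast
  qed
  have less: "h x < h y \<longleftrightarrow> x < y" for x y using diff1p_strict_mono[OF h] strict_mono_less by blast
  have a: "h a = a"
  proof (rule ccontr)
    assume "h a \<noteq> a"
    then consider "h a < a" | "a < h a" by linarith
    then show False
    proof cases
      case 1
      then have "h (h a) = h a" by (intro out) auto
      then show False using 1 less[of "h a" a] by simp
    next
      case 2
      have "h (dinv h a) = a" by (rule dinv_right[OF h])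
      then have "dinv h a < a" using 2 less[of "dinv h a" a] by simp
      then show False using out[of "dinv h a"] \<open>h (dinv h a) = a\<close> by simp
    qed
  qed
  have b: "h b = b"
  proof (rule ccontr)
    assume "h b \<noteq> b"
    then consider "h b > b" | "b > h b" by linarith
    then show False
    proof cases
      case 1
      then have "h (h b) = h b" by (intro out) auto
      then show False using 1 less[of b "h b"] by simp
    next
      case 2
      have "h (dinv h b) = b" by (rule dinv_right[OF h])
      then have "dinv h b > b" using 2 less[of b "dinv h b"] by simp
      then show False using out[of "dinv h b"] \<open>h (dinv h b) = b\<close> by simp
    qed
  qed
  show fixed: "h x = x" if "x \<le> a \<or> b \<le> x" for x using that a b out[of x] by (cases "x = a"; cases "x = b") auto
  show "D h x = 1" if "x \<in> {0..1}" "x \<le> a \<or> b \<le> x"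
    using that(2)
  proof
    assume "x \<le> a"
    then show ?thesis using D_eq_1[OF h, of 0 a x] ab that fixed by auto
  next
    assume "b \<le> x"
    then show ?thesis using D_eq_1[OF h, of b 1 x] ab that fixed by auto
  qed
  show "h x \<in> {a..b}" if "x \<in> {a..b}"
    using that diff1p_mono[OF h, of a x] diff1p_mono[OF h, of x b] a b by auto
qed

section \<open>Bump functions and their integrals\<close>

lemma plateau_function:
  fixes u' u v v' :: real
  assumes "u' < u" "v < v'"
  obtains \<theta> :: "real \<Rightarrow> real" where "continuous_on UNIV \<theta>" "\<And>x. 0 \<le> \<theta> x" "\<And>x. \<theta> x \<le> 1"
    "\<And>x. x \<in> {u..v} \<Longrightarrow> \<theta> x = 1" "\<And>x. x \<le> u' \<or> v' \<le> x \<Longrightarrow> \<theta> x = 0"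
proof (rule that[of "\<lambda>x. max 0 (min 1 (min ((x - u') / (u - u')) ((v' - x) / (v' - v))))"])
  show "continuous_on UNIV (\<lambda>x. max 0 (min 1 (min ((x - u') / (u - u')) ((v' - x) / (v' - v)))))"
    using assms by (intro continuous_intros) auto
  show "max 0 (min 1 (min ((x - u') / (u - u')) ((v' - x) / (v' - v)))) = 1" if "x \<in> {u..v}" for x
  proof -
    have "1 \<le> (x - u') / (u - u')" "1 \<le> (v' - x) / (v' - v)" using that assms by (auto simp: le_divide_eq_1)
    then show ?thesis by simp
  qed
  show "max 0 (min 1 (min ((x - u') / (u - u')) ((v' - x) / (v' - v)))) = 0" if "x \<le> u' \<or> v' \<le> x" for x
  proof -
    have "(x - u') / (u - u') \<le> 0 \<or> (v' - x) / (v' - v) \<le> 0"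
      using that assms by (auto simp: divide_le_0_iff)
    then show ?thesis by auto
  qed
qed auto

lemma integral_lower_bound:
  fixes \<theta> :: "real \<Rightarrow> real"
  assumes c: "continuous_on UNIV \<theta>" and "\<And>x. 0 \<le> \<theta> x" and m: "\<And>x. x \<in> {a..b} \<Longrightarrow> m \<le> \<theta> x"
    and ab: "0 \<le> a" "a \<le> b" "b \<le> 1"
  shows "m * (b - a) \<le> integral {0..1} \<theta>"
proof -
  have i: "\<theta> integrable_on {a..b}" for a b
    by (rule integrable_continuous_real) (rule continuous_on_subset[OF c], simp)
  have "m * (b - a) = integral {a..b} (\<lambda>x. m)" using ab by simp
  also have "\<dots> \<le> integral {a..b} \<theta>" by (rule integral_le) (use i m in auto)
  also have "\<dots> \<le> integral {0..1} \<theta>" by (rule integral_subset_le) (use i ab assms(2) in auto)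
  finally show ?thesis .
qed

lemma integral_vanishing:
  fixes \<theta> :: "real \<Rightarrow> real"
  assumes c: "continuous_on UNIV \<theta>" and z: "\<And>x. x \<le> a \<or> b \<le> x \<Longrightarrow> \<theta> x = 0"
  shows "x \<le> a \<Longrightarrow> integral {0..x} \<theta> = 0"
    and "b \<le> x \<Longrightarrow> 0 \<le> x \<Longrightarrow> x \<le> 1 \<Longrightarrow> integral {0..x} \<theta> = integral {0..1} \<theta>"
proof -
  show "integral {0..x} \<theta> = 0" if "x \<le> a"
    by (rule integral_unique, rule has_integral_is_0) (use that z in auto)
  assume x: "b \<le> x" "0 \<le> x" "x \<le> 1"
  have i: "\<theta> integrable_on {0..1}"
    by (rule integrable_continuous_real) (rule continuous_on_subset[OF c], simp)
  have "integral {x..1} \<theta> = 0"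
    by (rule integral_unique, rule has_integral_is_0) (use x z in auto)
  then show "integral {0..x} \<theta> = integral {0..1} \<theta>"
    using Henstock_Kurzweil_Integration.integral_combine[OF x(2,3) i] by simp
qed

text \<open>Only points moved to the right are treated. The opposite case reduces to this one by
  passing to the inverse of \<open>f\<close>.\<close>

locale fundamental_domain =
  fixes f :: "real \<Rightarrow> real" and \<alpha> :: real
  assumes f: "diff1p f" and nh: "no_hyperbolic_fixed_points f"
    and \<alpha>: "\<alpha> \<in> {0..1}" "\<alpha> < f \<alpha>"
begin

abbreviation "g \<equiv> dinv f"
abbreviation "\<beta> \<equiv> f \<alpha>"
abbreviation "\<gamma> \<equiv> dinv f \<alpha>"

lemma g: "diff1p g" by (rule diff1p_dinv(1)[OF f])

lemma f_less: "f x < f y \<longleftrightarrow> x < y" using diff1p_strict_mono[OF f] strict_mono_less by blast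
lemma g_less: "g x < g y \<longleftrightarrow> x < y" using diff1p_strict_mono[OF g] strict_mono_less by blast
lemma f_le: "f x \<le> f y \<longleftrightarrow> x \<le> y" using diff1p_strict_mono[OF f] strict_mono_less_eq by blast
lemma g_le: "g x \<le> g y \<longleftrightarrow> x \<le> y" using diff1p_strict_mono[OF g] strict_mono_less_eq by blast
lemma fg: "f (g x) = x" by (rule dinv_right[OF f])
lemma gf: "g (f x) = x" by (rule dinv_left[OF f])

lemma order: "0 < \<gamma>" "\<gamma> < \<alpha>" "\<beta> < 1"
proof -
  show "\<gamma> < \<alpha>" using g_less[of \<alpha> \<beta>] \<alpha> gf[of \<alpha>] by simp
  have "\<alpha> \<noteq> 0" using \<alpha> diff1p_0[OF f] by auto
  then show "0 < \<gamma>" using g_less[of 0 \<alpha>] \<alpha> diff1p_0[OF g] by auto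
  have "\<alpha> < 1" using \<alpha> diff1p_1[OF f] by (cases "\<alpha> = 1") auto
  then show "\<beta> < 1" using f_less[of \<alpha> 1] diff1p_1[OF f] by simp
qed

text \<open>A bump over two consecutive fundamental domains, from \<gamma> to \<beta>. A bump over
  one domain only would leave its sum over the orbit zero at the ends.\<close>

definition \<tau> :: "real \<Rightarrow> real" where "\<tau> x = max 0 ((x - \<gamma>) * (\<beta> - x))"

lemma \<tau>_continuous: "continuous_on S \<tau>"
  unfolding \<tau>_def by (intro continuous_intros)

lemma \<tau>_nonneg: "0 \<le> \<tau> x" by (simp add: \<tau>_def)

lemma \<tau>_zero: "x \<le> \<gamma> \<or> \<beta> \<le> x \<Longrightarrow> \<tau> x = 0"
proof -
  assume "x \<le> \<gamma> \<or> \<beta> \<le> x"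
  then have "(x - \<gamma>) * (\<beta> - x) \<le> 0"
    using order \<alpha> by (intro iffD2[OF mult_le_0_iff]) auto
  then show "\<tau> x = 0" by (simp add: \<tau>_def)
qed

lemma \<tau>_pos: "\<gamma> < x \<Longrightarrow> x < \<beta> \<Longrightarrow> 0 < \<tau> x"
  by (simp add: \<tau>_def)

text \<open>The density on the fundamental domain obtained by summing \<open>\<tau>\<close> over the orbits of \<open>f\<close>.\<close>

definition B :: "real \<Rightarrow> real" where "B y = \<tau> y + \<tau> (g y) * D g y"

lemma B_continuous: "continuous_on {\<alpha>..\<beta>} B"
proof -
  have sub: "{\<alpha>..\<beta>} \<subseteq> {0..1}" using order \<alpha> by auto
  show ?thesis unfolding B_def
    by (intro continuous_intros \<tau>_continuous continuous_on_compose2[OF \<tau>_continuous[of UNIV]]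
        continuous_on_subset[OF diff1p_continuous[OF g] sub] continuous_on_subset[OF diff1p_D_continuous[OF g] sub]) auto
qed

text \<open>One of \<open>y\<close> and \<open>g y\<close> lies strictly between \<gamma> and
  \<beta>: \<open>y\<close> itself, or \<open>g y = \<alpha>\<close> when
  \<open>y = \<beta>\<close>.\<close>

lemma B_pos: assumes "y \<in> {\<alpha>..\<beta>}" shows "0 < B y"
proof -
  have y: "y \<in> {0..1}" using assms order \<alpha> by auto
  have D: "0 < D g y" using diff1p_deriv(2)[OF g y] .
  show ?thesis
  proof (cases "y = \<beta>")
    case True
    then have "0 < \<tau> (g y)" using gf order \<alpha> by (intro \<tau>_pos) auto
    then show ?thesis using D \<tau>_nonneg[of y] by (simp add: B_def add_nonneg_pos)
  next
    case False
    then have "0 < \<tau> y" using assms order by (intro \<tau>_pos) auto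
    then show ?thesis using D \<tau>_nonneg[of "g y"] by (simp add: B_def add_pos_nonneg less_imp_le)
  qed
qed

section \<open>Orbits of the fundamental domain\<close>

lemma iterates:
  shows "\<alpha> \<le> (f ^^ n) \<alpha>" "(f ^^ n) \<beta> \<le> (f ^^ Suc n) \<beta>" "(g ^^ n) \<beta> \<le> \<beta>" "(g ^^ Suc n) \<alpha> \<le> (g ^^ n) \<alpha>"
proof -
  have 1: "(f ^^ n) \<alpha> < (f ^^ Suc n) \<alpha>" for n using \<alpha> f_less by (induction n) auto
  show "(f ^^ n) \<beta> \<le> (f ^^ Suc n) \<beta>" using 1[of "Suc n"] by (simp add: funpow_swap1)
  show "\<alpha> \<le> (f ^^ n) \<alpha>"
  proof (induction n)
    case (Suc n) then show ?case using 1[of n] by linarith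
  qed simp
  have 2: "(g ^^ Suc n) \<beta> < (g ^^ n) \<beta>" for n using \<alpha> g_less gf by (induction n) auto
  show "(g ^^ n) \<beta> \<le> \<beta>"
  proof (induction n)
    case (Suc n) then show ?case using 2[of n] by linarith
  qed simp
  have 3: "(g ^^ Suc n) \<alpha> < (g ^^ n) \<alpha>" for n using order g_less by (induction n) auto
  then show "(g ^^ Suc n) \<alpha> \<le> (g ^^ n) \<alpha>" by (simp add: less_imp_le)
qed

text \<open>Ensures that a plateau over this interval sees the first \<open>N\<close> iterates of
  the whole domain in both directions.\<close>

lemma iterates_J:
  assumes x: "x \<in> {\<alpha>..\<beta>}" and n: "n \<le> N"
  shows "(f ^^ n) x \<in> {(g ^^ N) \<alpha>..(f ^^ N) \<beta>}" "(g ^^ n) x \<in> {(g ^^ N) \<alpha>..(f ^^ N) \<beta>}"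
proof -
  have mf: "(f ^^ n) y \<le> (f ^^ n) z" "(g ^^ n) y \<le> (g ^^ n) z" if "y \<le> z" for y z
    using that diff1p_mono[OF diff1p_funpow[OF f]] diff1p_mono[OF diff1p_funpow[OF g]] by auto
  have fN: "(f ^^ n) \<beta> \<le> (f ^^ N) \<beta>" using n iterates(2) lift_Suc_mono_le[of "\<lambda>n. (f ^^ n) \<beta>"] by blast
  have gN: "(g ^^ N) \<alpha> \<le> (g ^^ n) \<alpha>" using n iterates(4) lift_Suc_antimono_le[of "\<lambda>n. (g ^^ n) \<alpha>"] by blast
  have f0: "\<beta> \<le> (f ^^ N) \<beta>" using iterates(2) lift_Suc_mono_le[of "\<lambda>n. (f ^^ n) \<beta>" 0 N] by simp
  have g0: "(g ^^ N) \<alpha> \<le> \<alpha>" using iterates(4) lift_Suc_antimono_le[of "\<lambda>n. (g ^^ n) \<alpha>" 0 N] by simp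
  show "(f ^^ n) x \<in> {(g ^^ N) \<alpha>..(f ^^ N) \<beta>}"
    using x mf(1)[of \<alpha> x] mf(1)[of x \<beta>] fN g0 iterates(1)[of n] by auto
  show "(g ^^ n) x \<in> {(g ^^ N) \<alpha>..(f ^^ N) \<beta>}"
    using x mf(2)[of \<alpha> x] mf(2)[of x \<beta>] gN f0 iterates(3)[of n] by auto
qed

text \<open>Transported by \<open>n\<close> iterations, a fixed point in between would lie strictly
  between \<alpha> and \<beta>, but \<open>f\<close> moves every point above \<alpha> above
  \<beta>.\<close>

lemma fixed_outside:
  assumes "f x = x"
  shows "x \<le> (g ^^ n) \<alpha> \<or> (f ^^ n) \<beta> \<le> x"
proof (rule ccontr)
  assume "\<not> ?thesis"
  then have x: "(g ^^ n) \<alpha> < x" "x < (f ^^ n) \<beta>" by auto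
  have fx: "(f ^^ n) x = x" "(g ^^ n) x = x" using assms gf[of x] by (induction n) auto
  have "(f ^^ n) ((g ^^ n) \<alpha>) = \<alpha>" by (induction n) (simp_all add: funpow_swap1[of f] fg)
  then have "\<alpha> < x" using x(1) diff1p_strict_mono[OF diff1p_funpow[OF f, of n]] fx strict_mono_less by metis
  have "(g ^^ n) ((f ^^ n) \<beta>) = \<beta>" by (induction n) (simp_all add: funpow_swap1[of g] gf)
  then have "x < \<beta>" using x(2) diff1p_strict_mono[OF diff1p_funpow[OF g, of n]] fx strict_mono_less by metis
  then show False using \<open>\<alpha> < x\<close> f_less[of \<alpha> x] assms by simp
qed

lemma \<tau>_integral_pos: "0 < integral {0..1} \<tau>"
proof -
  have o: "0 < \<alpha>" "\<alpha> < \<beta>" "\<beta> < 1" using order \<alpha> by auto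
  \<comment> \<open>Stopping at the midpoint keeps both factors of \<tau> bounded away from
    zero.\<close>
  define m where "m = (\<alpha> + \<beta>) / 2"
  have m: "\<alpha> < m" "m < \<beta>" using o by (auto simp: m_def)
  have "(\<alpha> - \<gamma>) * (\<beta> - m) * (m - \<alpha>) \<le> integral {0..1} \<tau>"
  proof (rule integral_lower_bound[OF \<tau>_continuous \<tau>_nonneg])
    fix x assume "x \<in> {\<alpha>..m}"
    then have "(\<alpha> - \<gamma>) * (\<beta> - m) \<le> (x - \<gamma>) * (\<beta> - x)" using m order by (intro mult_mono) auto
    then show "(\<alpha> - \<gamma>) * (\<beta> - m) \<le> \<tau> x" by (simp add: \<tau>_def)
  qed (use m o in auto)
  moreover have "0 < (\<alpha> - \<gamma>) * (\<beta> - m) * (m - \<alpha>)" using m order by simp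
  ultimately show ?thesis by linarith
qed

text \<open>\<open>h\<close> together with its translate \<open>f\<^sup>-\<^sup>1 \<circ> h \<circ> f\<close>, on the two domains that meet the support of \<open>\<tau>\<close>.\<close>

definition spread :: "(real \<Rightarrow> real) \<Rightarrow> real \<Rightarrow> real" where
  "spread h = h \<circ> (g \<circ> h \<circ> f)"

text \<open>The two factors act on adjacent domains and do not interfere. The last two parts add up
  to \<open>B (h x) * D h x\<close>: summed over the orbit, the transported bump is the pullback of
  \<open>B\<close> by \<open>h\<close>.\<close>

lemma spread:
  assumes h: "diff1p h" and s: "supp h \<subseteq> {\<alpha>..\<beta>}"
  shows "diff1p (spread h)"
    and "x \<le> \<gamma> \<or> \<beta> \<le> x \<Longrightarrow> spread h x = x"
    and "x \<in> {\<alpha>..\<beta>} \<Longrightarrow> \<tau> (spread h x) * D (spread h) x = \<tau> (h x) * D h x"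
    and "x \<in> {\<alpha>..\<beta>} \<Longrightarrow> \<tau> (spread h (g x)) * D (spread h) (g x) * D g x = \<tau> (g (h x)) * (D g (h x) * D h x)"
proof -
  note sup = supported[OF h _ _ _ s]
  have o: "0 < \<alpha>" "\<alpha> < \<beta>" "\<beta> < 1" using order \<alpha> by auto
  note sup = sup[OF o]
  have gh: "diff1p (g \<circ> h)" and ghf: "diff1p (g \<circ> h \<circ> f)" using diff1p_comp(1) f g h by auto
  show sp: "diff1p (spread h)" unfolding spread_def by (rule diff1p_comp(1)[OF h ghf])
  show "spread h x = x" if "x \<le> \<gamma> \<or> \<beta> \<le> x" for x
  proof -
    have "f x \<le> \<alpha> \<or> \<beta> \<le> f x" using that f_le[of x \<gamma>] f_le[of \<alpha> x] fg[of \<alpha>] \<alpha> by auto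
    then have "h (f x) = f x" using sup(1) by blast
    moreover have "h x = x" using that order sup(1)[of x] by auto
    ultimately show ?thesis by (simp add: spread_def gf)
  qed
  {
    assume x: "x \<in> {\<alpha>..\<beta>}"
    then have x01: "x \<in> {0..1}" using o by auto
    have fx: "f x \<in> {0..1}" "\<beta> \<le> f x" using diff1p_in[OF f x01] f_le[of \<alpha> x] x by auto
    \<comment> \<open>At \<open>x\<close> the inner factor of \<open>spread h\<close> is trivial, as
      \<open>f x\<close> lies beyond \<beta>.\<close>
    have hfx: "h (f x) = f x" "D h (f x) = 1" using sup(1,2)[of "f x"] fx by auto
    have gg: "D g (f x) * D f x = 1"
      using diff1p_dinv(2)[OF f fx(1)] diff1p_deriv(2)[OF f x01] by (simp add: gf)
    have "D (g \<circ> h \<circ> f) x = 1"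
      using diff1p_comp(2)[OF gh f x01] diff1p_comp(2)[OF g h fx(1)] hfx gg by simp
    then have "D (spread h) x = D h x"
      using diff1p_comp(2)[OF h ghf x01] hfx by (simp add: spread_def gf)
    moreover have "spread h x = h x" using hfx by (simp add: spread_def gf)
    ultimately show "\<tau> (spread h x) * D (spread h) x = \<tau> (h x) * D h x" by simp
    have hx: "h x \<in> {\<alpha>..\<beta>}" using sup(3)[OF x] .
    then have hx01: "h x \<in> {0..1}" using o by auto
    have ghx: "g (h x) \<le> \<alpha>" "g (h x) \<in> {0..1}" using g_le[of "h x" \<beta>] hx gf[of \<alpha>] diff1p_in[OF g hx01] by auto
    \<comment> \<open>At \<open>g x\<close> the outer factor is the trivial one.\<close>
    then have hg: "h (g (h x)) = g (h x)" "D h (g (h x)) = 1" using sup(1,2) by auto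
    have eq: "spread h \<circ> g = h \<circ> (g \<circ> h)" by (simp add: fun_eq_iff spread_def fg)
    have "D (spread h) (g x) * D g x = D (spread h \<circ> g) x" using diff1p_comp(2)[OF sp g x01] by simp
    also have "\<dots> = D g (h x) * D h x"
      unfolding eq using diff1p_comp(2)[OF h gh x01] diff1p_comp(2)[OF g h x01] hg by simp
    finally have "D (spread h) (g x) * D g x = D g (h x) * D h x" .
    moreover have "spread h (g x) = g (h x)" using hg by (simp add: spread_def fg)
    ultimately show "\<tau> (spread h (g x)) * D (spread h) (g x) * D g x = \<tau> (g (h x)) * (D g (h x) * D h x)"
      by (simp add: mult.assoc)
  }
qed

text \<open>The density \<open>1 - \<theta>\<close> is tiny on the plateau of \<open>\<theta>\<close>; the mass removed there is put back along \<open>\<tau>\<close>,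
  transported by \<open>spread h\<close>, so that this second part dominates on the fundamental domain. The factor
  \<open>c\<close> is fixed by \<open>k 1 = 1\<close>.\<close>

lemma concentrating_diffeo:
  assumes h: "diff1p h" and s: "supp h \<subseteq> {\<alpha>..\<beta>}" and N: "N \<ge> 1" and \<delta>: "0 < \<delta>" "\<delta> \<le> 1 / 2"
  obtains k \<theta> c where "diff1p k"
    "\<And>x. x \<in> {0..1} \<Longrightarrow> D k x = 1 - \<theta> x + c * (\<tau> (spread h x) * D (spread h) x)"
    "\<And>x. 0 \<le> \<theta> x" "\<And>x. \<theta> x \<le> 1" "\<And>x. x \<in> {(g ^^ N) \<alpha>..(f ^^ N) \<beta>} \<Longrightarrow> \<theta> x = 1 - \<delta>"
    "c \<ge> (\<beta> - \<alpha>) / 2 / integral {0..1} \<tau>" "c > 0"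
    "\<And>x. x \<in> {0..1} \<Longrightarrow> f x = x \<Longrightarrow> k x = x \<and> D k x = 1"
proof -
  note sp = spread[OF h s]
  let ?hh = "spread h"
  have o: "0 < \<alpha>" "\<alpha> < \<beta>" "\<beta> < 1" using order \<alpha> by auto
  define u v where "u = (g ^^ N) \<alpha>" and "v = (f ^^ N) \<beta>"
  have a01: "\<alpha> \<in> {0..1}" "\<beta> \<in> {0..1}" using o by auto
  have uv01: "u \<in> {0..1}" "v \<in> {0..1}"
    unfolding u_def v_def using diff1p_in[OF diff1p_funpow[OF g] a01(1)] diff1p_in[OF diff1p_funpow[OF f] a01(2)] by auto
  have gu01: "g u \<in> {0..1}" and fv01: "f v \<in> {0..1}" using diff1p_in g f uv01 by auto
  have u\<gamma>: "u \<le> \<gamma>" "\<beta> \<le> v"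
  proof -
    have "(g ^^ N) \<alpha> \<le> (g ^^ 1) \<alpha>" using N iterates(4) lift_Suc_antimono_le[of "\<lambda>n. (g ^^ n) \<alpha>" 1 N] by blast
    then show "u \<le> \<gamma>" by (simp add: u_def)
    have "(f ^^ 0) \<beta> \<le> (f ^^ N) \<beta>" using iterates(2) lift_Suc_mono_le[of "\<lambda>n. (f ^^ n) \<beta>" 0 N] by blast
    then show "\<beta> \<le> v" by (simp add: v_def)
  qed
  have u': "g u < u"
  proof -
    have "(g ^^ n) \<gamma> < (g ^^ n) \<alpha>" for n
      using order(2) diff1p_strict_mono[OF diff1p_funpow[OF g]] strict_mono_less by blast
    then show ?thesis by (simp add: u_def funpow_swap1)
  qed
  have v': "v < f v"
  proof -
    have "\<beta> < f \<beta>" using o f_less by simp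
    then have "(f ^^ n) \<beta> < (f ^^ n) (f \<beta>)" for n
      using diff1p_strict_mono[OF diff1p_funpow[OF f]] strict_mono_less by blast
    then show ?thesis by (simp add: v_def funpow_swap1)
  qed
  obtain \<theta>0 :: "real \<Rightarrow> real" where t0: "continuous_on UNIV \<theta>0" "\<And>x. 0 \<le> \<theta>0 x" "\<And>x. \<theta>0 x \<le> 1"
    "\<And>x. x \<in> {u..v} \<Longrightarrow> \<theta>0 x = 1" "\<And>x. x \<le> g u \<or> f v \<le> x \<Longrightarrow> \<theta>0 x = 0"
    using plateau_function[OF u' v'] by metis
  \<comment> \<open>The scaling leaves at least \<delta> of the original density everywhere, which
    keeps \<open>D k\<close> positive.\<close>
  define \<theta> where "\<theta> = (\<lambda>x. (1 - \<delta>) * \<theta>0 x)"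
  have t: "continuous_on UNIV \<theta>" "\<And>x. 0 \<le> \<theta> x" "\<And>x. x \<in> {u..v} \<Longrightarrow> \<theta> x = 1 - \<delta>"
    "\<And>x. x \<le> g u \<or> f v \<le> x \<Longrightarrow> \<theta> x = 0"
    using t0 \<delta> by (auto simp: \<theta>_def intro!: continuous_intros)
  have t_less: "\<theta> x < 1" for x
  proof -
    have "\<theta> x \<le> (1 - \<delta>) * 1" unfolding \<theta>_def using t0(3) \<delta> by (intro mult_left_mono) auto
    then show ?thesis using \<delta> by simp
  qed
  define \<Theta> T where "\<Theta> = (\<lambda>x. integral {0..x} \<theta>)" and "T = (\<lambda>x. integral {0..x} \<tau>)"
  have D\<Theta>: "(\<Theta> has_real_derivative \<theta> x) (at x within {0..1})" if "x \<in> {0..1}" for x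
    unfolding \<Theta>_def by (rule integral_has_real_derivative[OF continuous_on_subset[OF t(1)] that]) simp
  have DT: "(T has_real_derivative \<tau> x) (at x within {0..1})" if "x \<in> {0..1}" for x
    unfolding T_def by (rule integral_has_real_derivative[OF \<tau>_continuous that])
  \<comment> \<open>The plateau contains the fundamental domain and \<delta> is at most one half, so
    the removed mass has a bound independent of \<delta>, \<open>N\<close> and
    \<open>h\<close>.\<close>
  have \<Theta>1: "(\<beta> - \<alpha>) / 2 \<le> \<Theta> 1"
  proof -
    have "(1 - \<delta>) * (\<beta> - \<alpha>) \<le> \<Theta> 1" unfolding \<Theta>_def
      using t o u\<gamma> order by (intro integral_lower_bound) auto
    moreover have "1 / 2 * (\<beta> - \<alpha>) \<le> (1 - \<delta>) * (\<beta> - \<alpha>)" using \<delta> o by (intro mult_right_mono) auto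
    ultimately show ?thesis by simp
  qed
  have T1: "0 < T 1" using \<tau>_integral_pos by (simp add: T_def)
  define c where "c = \<Theta> 1 / T 1"
  have c: "c > 0" using \<Theta>1 T1 o by (simp add: c_def)
  define k where "k = (\<lambda>x. if x \<in> {0..1} then x - \<Theta> x + c * T (?hh x) else x)"
  have hh01: "?hh x \<in> {0..1}" if "x \<in> {0..1}" for x using diff1p_in[OF sp(1) that] .
  have Dk: "(k has_real_derivative 1 - \<theta> x + c * (\<tau> (?hh x) * D ?hh x)) (at x within {0..1})" if x: "x \<in> {0..1}" for x
  proof -
    have "(T \<circ> ?hh has_real_derivative \<tau> (?hh x) * D ?hh x) (at x within {0..1})"
    proof (rule DERIV_image_chain)
      show "(T has_real_derivative \<tau> (?hh x)) (at (?hh x) within ?hh ` {0..1})"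
        using DT[OF hh01[OF x]] diff1p_image[OF sp(1)] by simp
    qed (rule diff1p_deriv(1)[OF sp(1) x])
    then have "((\<lambda>x. x - \<Theta> x + c * (T \<circ> ?hh) x) has_real_derivative 1 - \<theta> x + c * (\<tau> (?hh x) * D ?hh x)) (at x within {0..1})"
      by (intro DERIV_add DERIV_diff DERIV_cmult DERIV_ident D\<Theta> x)
    then show ?thesis
      by (rule has_field_derivative_transform_within[OF _ zero_less_one x]) (simp add: k_def)
  qed
  \<comment> \<open>Left of \<open>g u\<close> nothing has been removed or put back; right of
    \<open>f v\<close> everything has, and the two masses agree.\<close>
  have kfix: "k x = x" if x: "x \<in> {0..1}" "x \<le> g u \<or> f v \<le> x" for x
    using x(2)
  proof
    assume a: "x \<le> g u"
    then have "x \<le> \<gamma>" using u' u\<gamma> by linarith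
    then have "T (?hh x) = 0" using sp(2)[of x] integral_vanishing(1)[OF \<tau>_continuous \<tau>_zero] by (simp add: T_def)
    moreover have "\<Theta> x = 0" unfolding \<Theta>_def by (rule integral_vanishing(1)[OF t(1,4) a])
    ultimately show ?thesis using x by (simp add: k_def)
  next
    assume a: "f v \<le> x"
    then have "\<beta> \<le> x" using v' u\<gamma> by linarith
    moreover from this have "T x = T 1" unfolding T_def
      by (intro integral_vanishing(2)[where a = \<gamma> and b = \<beta>, OF \<tau>_continuous \<tau>_zero]) (use x in auto)
    ultimately have "T (?hh x) = T 1" using sp(2)[of x] by simp
    moreover have "\<Theta> x = \<Theta> 1" unfolding \<Theta>_def by (rule integral_vanishing(2)[OF t(1,4) a]) (use x in auto)
    ultimately show ?thesis using x T1 by (simp add: k_def c_def)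
  qed
  have kpos: "0 < 1 - \<theta> x + c * (\<tau> (?hh x) * D ?hh x)" if x: "x \<in> {0..1}" for x
    using t_less[of x] c \<tau>_nonneg[of "?hh x"] diff1p_deriv(2)[OF sp(1) x]
    by (intro add_pos_nonneg mult_nonneg_nonneg) auto
  have k: "diff1p k"
  proof (rule diff1pI[OF _ _ _ Dk kpos])
    show "k 0 = 0" by (rule kfix) (use gu01 in auto)
    show "k 1 = 1" by (rule kfix) (use fv01 in auto)
    show "continuous_on {0..1} (\<lambda>x. 1 - \<theta> x + c * (\<tau> (?hh x) * D ?hh x))"
      by (intro continuous_intros continuous_on_subset[OF t(1)] diff1p_D_continuous sp
          continuous_on_compose2[OF \<tau>_continuous[of UNIV] diff1p_continuous]) auto
  qed (auto simp: k_def)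
  show thesis
  proof (rule that[OF k])
    show "D k x = 1 - \<theta> x + c * (\<tau> (?hh x) * D ?hh x)" if "x \<in> {0..1}" for x
      using D_eq[OF Dk[OF that] that] .
    show "k x = x \<and> D k x = 1" if x: "x \<in> {0..1}" "f x = x" for x
    proof -
      \<comment> \<open>The ramps of \<theta> end one iterate beyond its plateau, hence
        \<open>Suc N\<close>.\<close>
      have "x \<le> (g ^^ Suc N) \<alpha> \<or> (f ^^ Suc N) \<beta> \<le> x" using fixed_outside[OF x(2)] .
      then have out: "x \<le> g u \<or> f v \<le> x" by (simp add: u_def v_def)
      then have "x \<le> \<gamma> \<or> \<beta> \<le> x" using u' v' u\<gamma> by linarith
      then have "\<tau> (?hh x) = 0" using sp(2) \<tau>_zero by metis
      then show ?thesis using kfix[OF x(1) out] D_eq[OF Dk[OF x(1)] x(1)] t(4)[OF out] by simp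
    qed
    show "c \<ge> (\<beta> - \<alpha>) / 2 / integral {0..1} \<tau>"
      unfolding c_def T_def using \<Theta>1 \<tau>_integral_pos by (intro divide_right_mono) auto
  qed (use t t_less c in \<open>auto simp: less_imp_le u_def v_def\<close>)
qed

text \<open>On the fundamental domain the density of the average splits into the transported bump,
  which gives the pullback of \<open>B\<close>, and a background from \<open>1 - \<theta>\<close>.
  The first \<open>N\<close> background terms carry the factor \<delta>, and the later ones are
  suppressed by the weights.\<close>

lemma conjugator:
  assumes h: "diff1p h" and s: "supp h \<subseteq> {\<alpha>..\<beta>}" and d: "d > 0"
  obtains H c where "diff1p H" "\<And>x. x \<in> {0..1} \<Longrightarrow> f x = x \<Longrightarrow> H x = x \<and> D H x = 1"
    "quasi_inv H f d" "c > 0"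
    "\<And>x. x \<in> {\<alpha>..\<beta>} \<Longrightarrow> c * (B (h x) * D h x) \<le> D H x"
    "\<And>x. x \<in> {\<alpha>..\<beta>} \<Longrightarrow> D H x \<le> (1 + d) * (c * (B (h x) * D h x))"
proof -
  note sp = spread[OF h s]
  let ?hh = "spread h"
  have o: "0 < \<alpha>" "\<alpha> < \<beta>" "\<beta> < 1" using order \<alpha> by auto
  have sub: "{\<alpha>..\<beta>} \<subseteq> {0..1}" using o by auto
  have hJ: "h x \<in> {\<alpha>..\<beta>}" if "x \<in> {\<alpha>..\<beta>}" for x using supported(3)[OF h o s that] .
  \<comment> \<open>The decay \<open>exp (- d / 2) ^ n\<close> is split as
    \<open>r ^ n * r ^ n\<close>: one factor makes the terms from \<open>N\<close> on small, the
    other sums them.\<close>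
  define q r where "q = exp (- d)" and "r = exp (- d / 4)"
  have q: "0 < q" "q < 1" and r: "0 < r" "r < 1" using d by (auto simp: q_def r_def)
  obtain C where C: "C > 0"
    "\<And>n x. x \<in> {0..1} \<Longrightarrow> exp (- d) ^ n * (D (f ^^ n) x + D (dinv f ^^ Suc n) x) \<le> C * exp (- d / 2) ^ n"
    using D_orbit_bound[OF f nh d] by metis
  have rr: "exp (- d / 2) ^ n = r ^ n * r ^ n" for n
    by (simp add: r_def power_mult_distrib[symmetric] exp_add[symmetric])
  have "continuous_on {\<alpha>..\<beta>} (\<lambda>x. B (h x) * D h x)"
    by (intro continuous_intros continuous_on_compose2[OF B_continuous] continuous_on_subset[OF diff1p_continuous[OF h] sub]
        continuous_on_subset[OF diff1p_D_continuous[OF h] sub]) (use hJ in auto)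
  from continuous_attains_inf[OF compact_Icc _ this] o
  obtain z where z: "z \<in> {\<alpha>..\<beta>}" "\<And>x. x \<in> {\<alpha>..\<beta>} \<Longrightarrow> B (h z) * D h z \<le> B (h x) * D h x" by force
  define b where "b = B (h z) * D h z"
  have b: "b > 0" using B_pos[OF hJ[OF z(1)]] diff1p_deriv(2)[OF h, of z] sub z(1) by (auto simp: b_def)
  \<comment> \<open>This is \<open>d\<close> times a lower bound for the main term. The bound for
    \<open>c\<close> involves neither \<delta> nor \<open>N\<close>, so both may be chosen after
    \<eta>.\<close>
  define \<eta> where "\<eta> = d * ((\<beta> - \<alpha>) / 2 / integral {0..1} \<tau>) * b"
  have \<eta>: "\<eta> > 0" using d o b \<tau>_integral_pos by (simp add: \<eta>_def)
  define \<delta> where "\<delta> = min (1 / 2) (\<eta> * (1 - r) / C)"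
  have \<delta>: "0 < \<delta>" "\<delta> \<le> 1 / 2"
    unfolding \<delta>_def using \<eta> C(1) r by (simp, intro min.cobounded1)
  have \<delta>\<eta>: "C * \<delta> / (1 - r) \<le> \<eta>"
  proof -
    have "\<delta> \<le> \<eta> * (1 - r) / C" by (simp add: \<delta>_def)
    then have "C * \<delta> \<le> \<eta> * (1 - r)" using C(1) by (simp add: pos_le_divide_eq mult.commute)
    then show ?thesis using r by (simp add: pos_divide_le_eq)
  qed
  obtain N0 where N0: "r ^ N0 < \<delta>" using real_arch_pow_inv[OF \<delta>(1) r(2)] by blast
  \<comment> \<open>At least 1, so that the plateau reaches down to \<gamma> and contains the
    support of \<tau>.\<close>
  define N where "N = max 1 N0"
  have N: "N \<ge> 1" "r ^ N \<le> \<delta>"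
  proof -
    show "N \<ge> 1" by (simp add: N_def)
    have "r ^ N \<le> r ^ N0" using r by (intro power_decreasing) (auto simp: N_def)
    then show "r ^ N \<le> \<delta>" using N0 by linarith
  qed
  obtain k \<theta> c where k: "diff1p k"
    "\<And>x. x \<in> {0..1} \<Longrightarrow> D k x = 1 - \<theta> x + c * (\<tau> (?hh x) * D ?hh x)"
    and \<theta>: "\<And>x. 0 \<le> \<theta> x" "\<And>x. \<theta> x \<le> 1" "\<And>x. x \<in> {(g ^^ N) \<alpha>..(f ^^ N) \<beta>} \<Longrightarrow> \<theta> x = 1 - \<delta>"
    and c: "c \<ge> (\<beta> - \<alpha>) / 2 / integral {0..1} \<tau>" "c > 0"
    and kfix: "\<And>x. x \<in> {0..1} \<Longrightarrow> f x = x \<Longrightarrow> k x = x \<and> D k x = 1"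
    using concentrating_diffeo[OF h s N(1) \<delta>] by metis
  define H where "H = orbit_average (exp (- d)) f k"
  have *: "c * (B (h x) * D h x) \<le> D H x / ((1 - q) / 2) \<and>
      D H x / ((1 - q) / 2) \<le> (1 + d) * (c * (B (h x) * D h x))" if x: "x \<in> {\<alpha>..\<beta>}" for x
  proof -
    have x01: "x \<in> {0..1}" using x sub by blast
    have fn: "diff1p (f ^^ n)" "diff1p (g ^^ n)" for n using diff1p_funpow f g by auto
    have in01: "(f ^^ n) x \<in> {0..1}" "(g ^^ n) x \<in> {0..1}" for n using diff1p_in fn x01 by blast+
    have Dpos: "0 < D (f ^^ n) x" "0 < D (g ^^ n) x" for n using diff1p_deriv(2)[OF fn(1) x01] diff1p_deriv(2)[OF fn(2) x01] by auto
    define \<sigma> where "\<sigma> = (\<lambda>y. \<tau> (?hh y) * D ?hh y)"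
    define X Y where "X = (\<lambda>n. q ^ n * ((1 - \<theta> ((f ^^ n) x)) * D (f ^^ n) x + (1 - \<theta> ((g ^^ Suc n) x)) * D (g ^^ Suc n) x))"
      and "Y = (\<lambda>n. q ^ n * (\<sigma> ((f ^^ n) x) * D (f ^^ n) x + \<sigma> ((g ^^ Suc n) x) * D (g ^^ Suc n) x))"
    have "(\<lambda>n. (1 - q) / 2 * (X n + c * Y n)) sums D H x"
    proof -
      have e: "(1 - q) / 2 * (X n + c * Y n) = (1 - q) / 2 * (q ^ n *
           (D k ((f ^^ n) x) * D (f ^^ n) x + D k ((g ^^ Suc n) x) * D (g ^^ Suc n) x))" for n
        unfolding k(2)[OF in01(1)] k(2)[OF in01(2)] X_def Y_def \<sigma>_def by (simp only: algebra_simps)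
      show ?thesis unfolding e unfolding H_def q_def by (rule orbit_average(2)[OF f nh k(1) d x01])
    qed
    from sums_divide[OF this, of "(1 - q) / 2"] q
    have XY: "(\<lambda>n. X n + c * Y n) sums (D H x / ((1 - q) / 2))" by simp
    \<comment> \<open>Only \<open>x\<close> and \<open>g x\<close> can meet the support of the bump,
      and both belong to the term with index 0.\<close>
    have "\<sigma> ((f ^^ Suc n) x) = 0" "\<sigma> ((g ^^ Suc (Suc n)) x) = 0" for n
    proof -
      have "\<alpha> \<le> (f ^^ n) x" using iterates(1)[of n] diff1p_mono[OF fn(1), of \<alpha> x n] x by simp
      then have "\<beta> \<le> (f ^^ Suc n) x" using f_le by simp
      then show "\<sigma> ((f ^^ Suc n) x) = 0" using sp(2) \<tau>_zero unfolding \<sigma>_def by (metis mult_zero_left)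
      have "(g ^^ n) x \<le> \<beta>" using iterates(3)[of n] diff1p_mono[OF fn(2), of x \<beta> n] x by simp
      then have "g (g ((g ^^ n) x)) \<le> g (g \<beta>)" by (simp only: g_le)
      then have "(g ^^ Suc (Suc n)) x \<le> \<gamma>" by (simp add: gf)
      then show "\<sigma> ((g ^^ Suc (Suc n)) x) = 0" using sp(2) \<tau>_zero unfolding \<sigma>_def by (metis mult_zero_left)
    qed
    then have "Y n = 0" if "n \<notin> {0}" for n
      using that by (cases n) (simp_all add: Y_def del: funpow.simps)
    then have "Y sums sum Y {0}" by (intro sums_finite) auto
    then have "Y sums Y 0" by simp
    moreover have "Y 0 = B (h x) * D h x"
      using sp(3,4)[OF x] D_id[OF x01] by (simp add: Y_def \<sigma>_def B_def algebra_simps id_def o_def)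
    ultimately have Y: "Y sums (B (h x) * D h x)" by simp
    define S where "S = D H x / ((1 - q) / 2) - c * (B (h x) * D h x)"
    have X: "X sums S"
      using sums_diff[OF XY sums_mult[OF Y, of c]] by (simp add: S_def)
    have th: "0 \<le> 1 - \<theta> y" "1 - \<theta> y \<le> 1" for y using \<theta>(1,2)[of y] by auto
    have "0 \<le> X n" for n
      unfolding X_def using q th(1) Dpos by (intro mult_nonneg_nonneg add_nonneg_nonneg) (auto simp: less_imp_le simp del: funpow.simps)
    then have S0: "0 \<le> S" using sums_le[OF _ sums_zero X] by blast
    have Xle: "X n \<le> C * \<delta> * r ^ n" for n
    proof -
      \<comment> \<open>The strict inequality is needed because term \<open>n\<close> contains the
        iterate \<open>g ^^ Suc n\<close>.\<close>
      define m where "m = (if n < N then \<delta> else 1)"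
      have "1 - \<theta> ((f ^^ n) x) \<le> m" "1 - \<theta> ((g ^^ Suc n) x) \<le> m"
        using th(2) \<theta>(3)[OF iterates_J(1)[OF x, of n]] \<theta>(3)[OF iterates_J(2)[OF x, of "Suc n"]] by (auto simp: m_def)
      then have "X n \<le> q ^ n * (m * D (f ^^ n) x + m * D (g ^^ Suc n) x)"
        unfolding X_def using q Dpos[THEN less_imp_le] by (intro mult_left_mono add_mono mult_right_mono) (auto simp del: funpow.simps)
      also have "\<dots> = m * (q ^ n * (D (f ^^ n) x + D (g ^^ Suc n) x))" by (simp only: algebra_simps)
      also have "\<dots> \<le> m * (C * (r ^ n * r ^ n))"
        using C(2)[OF x01, of n] \<delta> unfolding rr q_def by (intro mult_left_mono) (auto simp: m_def simp del: funpow.simps)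
      also have "\<dots> = C * (m * r ^ n) * r ^ n" by simp
      also have "\<dots> \<le> C * \<delta> * r ^ n"
      proof -
        have "m * r ^ n \<le> \<delta>"
        proof (cases "n < N")
          case True
          then show ?thesis using \<delta> r by (simp add: m_def mult_left_le power_le_one)
        next
          case False
          then have "r ^ n \<le> r ^ N" using r by (intro power_decreasing) auto
          then show ?thesis using N(2) False by (simp add: m_def)
        qed
        then show ?thesis using C r by (intro mult_right_mono mult_left_mono) auto
      qed
      finally show ?thesis .
    qed
    have "(\<lambda>n. C * \<delta> * r ^ n) sums (C * \<delta> * (1 / (1 - r)))"
      using r by (intro sums_mult geometric_sums) auto
    from sums_le[OF Xle X this] have "S \<le> \<eta>" using \<delta>\<eta> by simp
    \<comment> \<open>Here the minimum \<open>b\<close> and the lower bound for \<open>c\<close>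
      make the background at most \<open>d\<close> times the main term.\<close>
    also have "\<eta> \<le> d * c * (B (h x) * D h x)" unfolding \<eta>_def
      using c d b o \<tau>_integral_pos z(2)[OF x] by (intro mult_mono) (auto simp: b_def)
    finally have "S \<le> d * (c * (B (h x) * D h x))" by simp
    then show ?thesis using S0 unfolding S_def by (simp add: distrib_right)
  qed
  show thesis
  proof (rule that[of H "(1 - q) / 2 * c"])
    show "diff1p H" unfolding H_def by (rule orbit_average(1)[OF f nh k(1) d])
    show "H x = x \<and> D H x = 1" if "x \<in> {0..1}" "f x = x" for x
      unfolding H_def using orbit_average_fixed[OF f d that(2)] orbit_average_D_fixed[OF f nh k(1) d that] kfix[OF that] by blast
    show "quasi_inv H f d" unfolding H_def by (rule orbit_average_quasi_inv[OF f nh k(1) d])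
    show "0 < (1 - q) / 2 * c" using q c by simp
    fix x assume "x \<in> {\<alpha>..\<beta>}"
    from *[OF this] q show "(1 - q) / 2 * c * (B (h x) * D h x) \<le> D H x"
      "D H x \<le> (1 + d) * ((1 - q) / 2 * c * (B (h x) * D h x))"
      by (simp_all add: field_simps)
  qed
qed

text \<open>Uniform continuity becomes a multiplicative estimate through the positive minimum of
  \<open>B\<close>. The modulus does not depend on any conjugator.\<close>

lemma B_modulus:
  assumes "\<eta> > 0"
  obtains \<rho> where "\<rho> > 0" "\<And>y y'. y \<in> {\<alpha>..\<beta>} \<Longrightarrow> y' \<in> {\<alpha>..\<beta>} \<Longrightarrow> \<bar>y' - y\<bar> < \<rho> \<Longrightarrow> B y' \<le> exp \<eta> * B y"
proof -
  obtain z where z: "z \<in> {\<alpha>..\<beta>}" "\<And>x. x \<in> {\<alpha>..\<beta>} \<Longrightarrow> B z \<le> B x"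
    using continuous_attains_inf[OF compact_Icc _ B_continuous] \<alpha> by force
  have pos: "B z * (exp \<eta> - 1) > 0" using B_pos[OF z(1)] assms by simp
  have "uniformly_continuous_on {\<alpha>..\<beta>} B" by (rule compact_uniformly_continuous[OF B_continuous compact_Icc])
  then obtain \<rho> where \<rho>: "\<rho> > 0"
    "\<And>y y'. y \<in> {\<alpha>..\<beta>} \<Longrightarrow> y' \<in> {\<alpha>..\<beta>} \<Longrightarrow> dist y' y < \<rho> \<Longrightarrow> dist (B y') (B y) < B z * (exp \<eta> - 1)"
    using pos unfolding uniformly_continuous_on_def by metis
  show thesis
  proof (rule that[OF \<rho>(1)])
    fix y y' assume y: "y \<in> {\<alpha>..\<beta>}" "y' \<in> {\<alpha>..\<beta>}" "\<bar>y' - y\<bar> < \<rho>"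
    then have "B y' - B y < B z * (exp \<eta> - 1)" using \<rho>(2)[of y y'] by (simp add: dist_real_def)
    also have "\<dots> \<le> B y * (exp \<eta> - 1)" using z(2)[OF y(1)] assms by (intro mult_right_mono) auto
    finally show "B y' \<le> exp \<eta> * B y" by (simp add: algebra_simps)
  qed
qed

text \<open>Up to a constant and a factor in \<open>[1, 1 + d]\<close>, \<open>D H\<close> is the
  pullback of \<open>B\<close> by \<open>h\<close>. Under \<open>p\<close> the factor
  \<open>D h\<close> changes by at most \<open>exp \<eta>\<close> by almost invariance, and
  \<open>B\<close> by at most \<open>exp \<eta>\<close> because the conjugate moves points less than
  \<rho>. Off the domain \<open>p\<close> is trivial.\<close>

lemma quasi_inv_supported:
  assumes h: "diff1p h" "supp h \<subseteq> {\<alpha>..\<beta>}" and H: "diff1p H" and p: "diff1p p" "supp p \<subseteq> {\<alpha>..\<beta>}"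
    and c: "c > 0" and d: "d > 0"
    and lo: "\<And>x. x \<in> {\<alpha>..\<beta>} \<Longrightarrow> c * (B (h x) * D h x) \<le> D H x"
    and hi: "\<And>x. x \<in> {\<alpha>..\<beta>} \<Longrightarrow> D H x \<le> (1 + d) * (c * (B (h x) * D h x))"
    and \<rho>: "\<And>y y'. y \<in> {\<alpha>..\<beta>} \<Longrightarrow> y' \<in> {\<alpha>..\<beta>} \<Longrightarrow> \<bar>y' - y\<bar> < \<rho> \<Longrightarrow> B y' \<le> exp \<eta> * B y"
    and near: "C1dist (conj h p) id < \<rho>" and q: "quasi_inv h p \<eta>" and \<eta>: "\<eta> \<ge> 0"
  shows "quasi_inv H p (d + 2 * \<eta>)"
  unfolding quasi_inv_def
proof
  fix x :: real assume x01: "x \<in> {0..1}"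
  have o: "0 < \<alpha>" "\<alpha> < \<beta>" "\<beta> < 1" using order \<alpha> by auto
  have sub: "y \<in> {0..1}" if "y \<in> {\<alpha>..\<beta>}" for y using o that by auto
  note sh = supported[OF h(1) o h(2)] and sp = supported[OF p(1) o p(2)]
  show "exp (- (d + 2 * \<eta>)) * D H x \<le> D H (p x) * D p x \<and> D H (p x) * D p x \<le> exp (d + 2 * \<eta>) * D H x"
  proof (cases "x \<in> {\<alpha>..\<beta>}")
    case False
    then have "p x = x" "D p x = 1" using sp(1,2)[of x] x01 by auto
    then show ?thesis using d \<eta> diff1p_deriv(2)[OF H x01] by simp
  next
    case x: True
    have px: "p x \<in> {\<alpha>..\<beta>}" using sp(3)[OF x] .
    have J: "h x \<in> {\<alpha>..\<beta>}" "h (p x) \<in> {\<alpha>..\<beta>}" using sh(3) x px by auto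
    have "\<bar>conj h p (h x) - id (h x)\<bar> < \<rho>"
      using C1dist_upper(1)[OF diff1p_conj[OF h(1) p(1)] diff1p_id sub[OF J(1)]] near by linarith
    then have cl: "\<bar>h (p x) - h x\<bar> < \<rho>" by (simp add: conj_def dinv_left[OF h(1)])
    have B1: "B (h (p x)) \<le> exp \<eta> * B (h x)" "B (h x) \<le> exp \<eta> * B (h (p x))"
      using \<rho>[OF J cl] \<rho>[OF J(2) J(1)] cl by (auto simp: abs_minus_commute)
    have q1: "exp (- \<eta>) * D h x \<le> D h (p x) * D p x" "D h (p x) * D p x \<le> exp \<eta> * D h x"
      using q x01 unfolding quasi_inv_def by auto
    have pos: "0 < B (h x)" "0 < B (h (p x))" "0 < D h x" "0 < D p x" "0 < D h (p x)" "0 < D H x"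
      using B_pos J diff1p_deriv(2) h(1) p(1) H x01 sub px by auto
    have ed: "1 + d \<le> exp d" by (rule exp_ge_add_one_self)
    have mm: "a * (c * (b * w)) \<le> a' * (c * (b' * w'))"
      if "0 \<le> a" "a \<le> a'" "0 \<le> b" "b \<le> b'" "0 \<le> w" "w \<le> w'" for a a' b b' w w' :: real
      using that c by (intro mult_mono) auto
    have "D H (p x) * D p x \<le> ((1 + d) * (c * (B (h (p x)) * D h (p x)))) * D p x"
      using hi[OF px] pos by (intro mult_right_mono) auto
    also have "\<dots> = (1 + d) * (c * (B (h (p x)) * (D h (p x) * D p x)))" by simp
    also have "\<dots> \<le> exp d * (c * ((exp \<eta> * B (h x)) * (exp \<eta> * D h x)))"
      using ed B1 q1 pos d by (intro mm) auto
    also have "\<dots> = exp (d + 2 * \<eta>) * (c * (B (h x) * D h x))"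
      by (simp add: exp_add exp_double power2_eq_square)
    also have "\<dots> \<le> exp (d + 2 * \<eta>) * D H x" using lo[OF x] by (intro mult_left_mono) auto
    finally have up: "D H (p x) * D p x \<le> exp (d + 2 * \<eta>) * D H x" .
    have "D H x \<le> (1 + d) * (c * (B (h x) * D h x))" by (rule hi[OF x])
    also have "\<dots> \<le> exp d * (c * ((exp \<eta> * B (h (p x))) * (exp \<eta> * (D h (p x) * D p x))))"
    proof -
      have "D h x \<le> exp \<eta> * (D h (p x) * D p x)" using q1(1) by (simp add: exp_minus field_simps)
      then show ?thesis using ed B1 pos d by (intro mm) auto
    qed
    also have "\<dots> = exp (d + 2 * \<eta>) * ((c * (B (h (p x)) * D h (p x))) * D p x)"
      by (simp add: exp_add exp_double power2_eq_square)
    also have "\<dots> \<le> exp (d + 2 * \<eta>) * (D H (p x) * D p x)"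
      using lo[OF px] pos by (intro mult_left_mono mult_right_mono) auto
    finally have "D H x \<le> exp (d + 2 * \<eta>) * (D H (p x) * D p x)" .
    from mult_left_mono[OF this, of "exp (- (d + 2 * \<eta>))"]
    have "exp (- (d + 2 * \<eta>)) * D H x \<le> D H (p x) * D p x"
      by (simp add: mult.assoc[symmetric] exp_add[symmetric])
    with up show ?thesis by blast
  qed
qed

text \<open>Each \<open>h n\<close> is processed with tolerance \<open>d n\<close> tending to 0. For
  a fixed \<open>p\<close> the required closeness depends only on \<open>e\<close>, so convergence
  for each element separately suffices.\<close>

lemma conjugating_sequence:
  assumes G: "\<And>p. p \<in> G \<Longrightarrow> diff1p p" "\<And>p. p \<in> G \<Longrightarrow> supp p \<subseteq> {\<alpha>..\<beta>}"
    and h: "\<And>n. diff1p (h n)" "\<And>n. supp (h n) \<subseteq> {\<alpha>..\<beta>}"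
    and lim: "\<And>p. p \<in> G \<Longrightarrow> (\<lambda>n. C1dist (conj (h n) p) id) \<longlonglongrightarrow> 0"
  obtains H where "\<And>n. diff1p (H n)" "\<And>n x. x \<in> {0..1} \<Longrightarrow> f x = x \<Longrightarrow> H n x = x \<and> D (H n) x = 1"
    "\<And>p e. p \<in> insert f G \<Longrightarrow> e > 0 \<Longrightarrow> \<forall>\<^sub>F n in sequentially. quasi_inv (H n) p e"
proof -
  define d where "d = (\<lambda>n. 1 / real (Suc n))"
  have d: "d n > 0" for n by (simp add: d_def)
  have d0: "d \<longlonglongrightarrow> 0" unfolding d_def using LIMSEQ_inverse_real_of_nat by (simp add: inverse_eq_divide)
  have "\<exists>H c. diff1p H \<and> (\<forall>x. x \<in> {0..1} \<longrightarrow> f x = x \<longrightarrow> H x = x \<and> D H x = 1) \<and> quasi_inv H f (d n) \<and> c > 0 \<and>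
    (\<forall>x. x \<in> {\<alpha>..\<beta>} \<longrightarrow> c * (B (h n x) * D (h n) x) \<le> D H x \<and> D H x \<le> (1 + d n) * (c * (B (h n x) * D (h n) x)))" for n
    using conjugator[OF h d[of n]] by metis
  then obtain H c where H: "\<And>n. diff1p (H n)" "\<And>n x. x \<in> {0..1} \<Longrightarrow> f x = x \<Longrightarrow> H n x = x \<and> D (H n) x = 1"
    "\<And>n. quasi_inv (H n) f (d n)" and c: "\<And>n. c n > 0"
    "\<And>n x. x \<in> {\<alpha>..\<beta>} \<Longrightarrow> c n * (B (h n x) * D (h n) x) \<le> D (H n) x"
    "\<And>n x. x \<in> {\<alpha>..\<beta>} \<Longrightarrow> D (H n) x \<le> (1 + d n) * (c n * (B (h n x) * D (h n) x))"
    by metis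
  have mono: "quasi_inv (H n) p e" if "quasi_inv (H n) p e'" "e' \<le> e" for n p e e'
    unfolding quasi_inv_def
  proof
    fix x :: real assume x: "x \<in> {0..1}"
    have "exp (- e) * D (H n) x \<le> exp (- e') * D (H n) x" "exp e' * D (H n) x \<le> exp e * D (H n) x"
      using that(2) diff1p_deriv(2)[OF H(1) x, of n] by (auto intro!: mult_right_mono)
    then show "exp (- e) * D (H n) x \<le> D (H n) (p x) * D p x \<and> D (H n) (p x) * D p x \<le> exp e * D (H n) x"
      using that(1) x unfolding quasi_inv_def by fastforce
  qed
  have ev: "\<forall>\<^sub>F n in sequentially. d n < e" if "e > 0" for e using order_tendstoD(2)[OF d0 that] .
  show thesis
  proof (rule that[OF H(1,2)])
    fix p and e :: real assume p: "p \<in> insert f G" and e: "e > 0"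
    show "\<forall>\<^sub>F n in sequentially. quasi_inv (H n) p e"
    proof (cases "p = f")
      case True
      then show ?thesis using ev[OF e] by (auto elim!: eventually_mono intro: mono[OF H(3)])
    next
      case False
      then have pG: "p \<in> G" using p by simp
      \<comment> \<open>Together with \<open>d n < e / 2\<close> this keeps
        \<open>d n + 2 * \<eta>\<close> below \<open>e\<close>.\<close>
      define \<eta> where "\<eta> = e / 4"
      have \<eta>: "\<eta> > 0" using e by (simp add: \<eta>_def)
      obtain \<rho> where \<rho>: "\<rho> > 0" "\<And>y y'. y \<in> {\<alpha>..\<beta>} \<Longrightarrow> y' \<in> {\<alpha>..\<beta>} \<Longrightarrow> \<bar>y' - y\<bar> < \<rho> \<Longrightarrow> B y' \<le> exp \<eta> * B y"
        using B_modulus[OF \<eta>] by metis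
      have "\<forall>\<^sub>F n in sequentially. C1dist (conj (h n) p) id < \<rho>"
        "\<forall>\<^sub>F n in sequentially. C1dist (conj (h n) p) id < 1 - exp (- \<eta>)"
        using order_tendstoD(2)[OF lim[OF pG]] \<rho>(1) \<eta> by auto
      moreover have "\<forall>\<^sub>F n in sequentially. d n < e / 2" using e by (intro ev) simp
      ultimately show ?thesis
      proof eventually_elim
        case (elim n)
        have "quasi_inv (h n) p \<eta>" by (rule C1dist_quasi_inv[OF h(1) G(1)[OF pG] elim(2) \<eta>])
        then have "quasi_inv (H n) p (d n + 2 * \<eta>)"
          using \<eta> by (intro quasi_inv_supported[OF h H(1) G(1,2)[OF pG] c(1) d c(2,3) \<rho>(2) elim(1)]) auto
        then show ?case by (rule mono) (use elim in \<open>simp add: \<eta>_def\<close>)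
      qed
    qed
  qed
qed

end

section \<open>The two orientations and the conclusion\<close>

lemma dinv_dinv: assumes "diff1p f" shows "dinv (dinv f) = f"
proof
  fix x
  have "f (dinv f (dinv (dinv f) x)) = f x" using dinv_right[OF diff1p_dinv(1)[OF assms]] by simp
  then show "dinv (dinv f) x = f x" by (simp add: dinv_right[OF assms])
qed

theorem theoremt:
  fixes f :: "real \<Rightarrow> real" and x0 :: real and G :: "(real \<Rightarrow> real) set"
    and h :: "real \<Rightarrow> real \<Rightarrow> real"
  assumes "diff1p f" and "no_hyperbolic_fixed_points f"
    and "x0 \<in> {0..1}" and "f x0 \<noteq> x0"
    and "is_diff_group G"
    and "\<forall>g\<in>G. supp g \<subseteq> {min x0 (f x0)..max x0 (f x0)}"
    and "C1_path h"
    and "\<forall>t\<in>{0..<1}. supp (h t) \<subseteq> {min x0 (f x0)..max x0 (f x0)}"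
    and "\<forall>g\<in>G. ((\<lambda>t. C1dist (conj (h t) g) id) \<longlongrightarrow> 0) (at_left 1)"
  shows "(\<exists>H :: real \<Rightarrow> real \<Rightarrow> real. C1_path H \<and>
            (\<forall>t\<in>{0..<1}. supp (H t) \<subseteq> supp f \<and> D (H t) 0 = 1 \<and> D (H t) 1 = 1) \<and>
            (\<forall>g\<in>gen_group (insert f G).
               ((\<lambda>t. C1dist (conj (H t) g) id) \<longlongrightarrow> 0) (at_left 1)))
         \<and> C1_close_to_id (gen_group (insert f G))"
proof -
  note df = assms(1) and nhf = assms(2)
  have G: "diff1p p" if "p \<in> G" for p using assms(5) that by (simp add: is_diff_group_def)
  \<comment> \<open>Any sequence in \<open>{0..<1}\<close> tending to 1 would do; the path is
    recovered by interpolating the new conjugators.\<close>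
  define t where "t = (\<lambda>n. 1 - 1 / real (Suc n))"
  have t: "t n \<in> {0..<1}" and t1: "t n \<noteq> 1" for n by (simp_all add: t_def)
  have "t \<longlonglongrightarrow> 1 - 0" unfolding t_def
    using LIMSEQ_inverse_real_of_nat by (intro tendsto_intros) (simp add: inverse_eq_divide)
  then have tl: "filterlim t (at_left 1) sequentially"
    using t t1 by (auto simp: filterlim_at intro!: always_eventually)
  have h: "diff1p (h (t n))" for n using assms(7) t unfolding C1_path_def by blast
  have lim: "(\<lambda>n. C1dist (conj (h (t n)) p) id) \<longlonglongrightarrow> 0" if "p \<in> G" for p
    using filterlim_compose[OF bspec[OF assms(9) that] tl] .
  have "\<exists>H. (\<forall>n. diff1p (H n)) \<and> (\<forall>n x. x \<in> {0..1} \<longrightarrow> f x = x \<longrightarrow> H n x = x \<and> D (H n) x = 1) \<and>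
    (\<forall>p e. p \<in> insert f G \<longrightarrow> e > 0 \<longrightarrow> (\<forall>\<^sub>F n in sequentially. quasi_inv (H n) p e))"
  proof (cases "x0 < f x0")
    case True
    then interpret fundamental_domain f x0 using assms by unfold_locales auto
    have "supp p \<subseteq> {x0..f x0}" if "p \<in> G" for p using assms(6) that True by auto
    moreover have "supp (h (t n)) \<subseteq> {x0..f x0}" for n using assms(8) t[of n] True by auto
    ultimately show ?thesis using conjugating_sequence[of G "\<lambda>n. h (t n)"] G h lim by metis
  next
    case False
    then have less: "f x0 < x0" using assms(4) by simp
    have x1: "dinv f (f x0) = x0" by (rule dinv_left[OF df])
    \<comment> \<open>For the inverse map the domain starts at \<open>f x0\<close> and ends at
      \<open>x0\<close>, so it is the same interval.\<close>
    interpret fundamental_domain "dinv f" "f x0"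
      using diff1p_dinv(1)[OF df] no_hyperbolic_dinv[OF df nhf] diff1p_in[OF df assms(3)] less x1
      by unfold_locales auto
    have "supp p \<subseteq> {f x0..dinv f (f x0)}" if "p \<in> G" for p using assms(6) that less x1 by auto
    moreover have "supp (h (t n)) \<subseteq> {f x0..dinv f (f x0)}" for n using assms(8) t[of n] less x1 by auto
    ultimately obtain H where H: "\<And>n. diff1p (H n)" "\<And>n x. x \<in> {0..1} \<Longrightarrow> dinv f x = x \<Longrightarrow> H n x = x \<and> D (H n) x = 1"
      "\<And>p e. p \<in> insert (dinv f) G \<Longrightarrow> e > 0 \<Longrightarrow> \<forall>\<^sub>F n in sequentially. quasi_inv (H n) p e"
      using conjugating_sequence[of G "\<lambda>n. h (t n)"] G h lim by metis
    \<comment> \<open>Almost invariance under the inverse is almost invariance under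
      \<open>f\<close>, and the two maps have the same fixed points.\<close>
    have "\<forall>\<^sub>F n in sequentially. quasi_inv (H n) f e" if "e > 0" for e
      using H(3)[of "dinv f" e] that quasi_inv_dinv[OF diff1p_dinv(1)[OF df]]
      by (auto simp: dinv_dinv[OF df] elim!: eventually_mono)
    moreover have "dinv f x = x" if "f x = x" for x using dinv_left[OF df, of x] that by simp
    ultimately show ?thesis using H by (intro exI[of _ H]) auto
  qed
  then obtain H where H: "\<And>n. diff1p (H n)" "\<And>n x. x \<in> {0..1} \<Longrightarrow> f x = x \<Longrightarrow> H n x = x \<and> D (H n) x = 1"
    "\<And>p e. p \<in> insert f G \<Longrightarrow> e > 0 \<Longrightarrow> \<forall>\<^sub>F n in sequentially. quasi_inv (H n) p e"
    by metis
  show ?thesis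
    by (rule conjugating_path_of_sequence[OF H(1) _ H(3)])
      (use df G H(2) diff1p_0[OF df] diff1p_1[OF df] in auto)
qed

end
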